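(* Let $E,F$ be Banach spaces such that there exists a quotient mapping $\rho:E\to F$. If $\mathcal P_w({}^nE,F)$ is an HB-subspace of $\mathcal P({}^nE,F)$ for some $n\in\mathbb N$, then $F$ is an HB-subspace of $F^{**}$.
   Context: All Banach spaces are over $\mathbb K=\mathbb R$ or $\mathbb C$ (the same field for $E$ and $F$); $B_E$ is the closed unit ball, and $\mathbb N=\{1,2,\dots\}$. $\mathcal P({}^nE,F)$ is the Banach space of continuous $n$-homogeneous polynomials $P:E\to F$ with norm $\|P\|=\sup_{x\in B_E}\|P(x)\|$. $\mathcal P_w({}^nE,F)$ is the subspace of those polynomials that are weakly continuous on bounded sets, i.e. that map bounded weakly convergent nets to norm-convergent nets. A quotient mapping is a bounded linear operator mapping the open unit ball of the domain onto the open unit ball of the range (so its adjoint is an isometric embedding). For a closed subspace $J$ of a Banach space $X$, $J^\perp=\{x^*\in X^*: x^*(y)=0\ \forall y\in J\}$. $J$ is an HB-subspace of $X$ if there is a linear projection $q$ on $X^*$ with $\ker q=J^\perp$ such that for each $f\in X^*$ with $f\ne qf$ one has $\|qf\|<\|f\|$ and $\|f-qf\|\le\|f\|$. $F$ is regarded as a subspace of $F^{**}$ through the canonical embedding. *)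

theory Defs
  imports "HOL-Analysis.Analysis" "HOL-Library.Function_Algebras"
begin

section \<open>The scalar field\<close>

text \<open>
  The two instances below are the intended ones. The assumption says that the field is
  isometrically isomorphic to the real or the complex numbers.
\<close>

class real_or_complex = real_normed_field +
  assumes real_or_complex_iso:
    "\<exists>h :: 'a \<Rightarrow> complex.
       (\<forall>x y. h (x + y) = h x + h y) \<and> (\<forall>x y. h (x * y) = h x * h y) \<and>
       (\<forall>x. norm (h x) = norm x) \<and> (range h = \<real> \<or> range h = UNIV)"

instance real :: real_or_complex
  by standard (rule exI[of _ complex_of_real], simp add: Reals_def)

instance complex :: real_or_complex
  by standard (rule exI[of _ "\<lambda>z. z"], simp)


section \<open>Banach spaces over the scalar field\<close>

text \<open>
  The type class fixes only the underlying real Banach space; the scalar multiplication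
  over \<open>'k\<close> is a parameter that extends the real one.
\<close>

locale banach_over = vector_space scale
  for scale :: "'k::real_or_complex \<Rightarrow> 'a::banach \<Rightarrow> 'a" +
  assumes scale_of_real: "scale (of_real r) x = r *\<^sub>R x"
    and norm_scale: "norm (scale c x) = norm c * norm x"

text \<open>
  Spaces of polynomials and dual spaces are not types of their own here, since they depend
  on the scalar multiplications. They are given by a carrier inside a function type, with
  pointwise addition, together with a scalar multiplication and a norm. Only the values of
  \<open>nrm\<close> and \<open>smul\<close> on the carrier are relevant.
\<close>

record ('k, 'v) nspace =
  carr :: "'v set"
  smul :: "'k \<Rightarrow> 'v \<Rightarrow> 'v"
  nrm :: "'v \<Rightarrow> real"

definition of_type :: "('k \<Rightarrow> 'v \<Rightarrow> 'v) \<Rightarrow> ('k, 'v::real_normed_vector) nspace" where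
  "of_type s = \<lparr>carr = UNIV, smul = s, nrm = norm\<rparr>"

definition linear_between ::
    "('k, 'v::ab_group_add) nspace \<Rightarrow> ('k, 'w::ab_group_add) nspace \<Rightarrow> ('v \<Rightarrow> 'w) \<Rightarrow> bool" where
  "linear_between V W T \<longleftrightarrow>
     (\<forall>x\<in>carr V. T x \<in> carr W) \<and>
     (\<forall>x\<in>carr V. \<forall>y\<in>carr V. T (x + y) = T x + T y) \<and>
     (\<forall>c. \<forall>x\<in>carr V. T (smul V c x) = smul W c (T x))"

text \<open>
  Functionals are normalised to vanish outside the carrier, so that two functionals are
  equal as soon as they agree on the carrier.
\<close>

definition dual :: "('k::real_or_complex, 'v::ab_group_add) nspace \<Rightarrow> ('k, 'v \<Rightarrow> 'k) nspace" where
  "dual V =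
     \<lparr>carr = {f. linear_between V (of_type (*)) f \<and>
                 (\<exists>B. \<forall>x\<in>carr V. norm (f x) \<le> B * nrm V x) \<and>
                 (\<forall>x. x \<notin> carr V \<longrightarrow> f x = 0)},
      smul = (\<lambda>c f x. c * f x),
      nrm = (\<lambda>f. SUP x\<in>{x \<in> carr V. nrm V x \<le> 1}. norm (f x))\<rparr>"

definition canonical_embedding ::
    "('k::real_or_complex, 'v::ab_group_add) nspace \<Rightarrow> 'v \<Rightarrow> ('v \<Rightarrow> 'k) \<Rightarrow> 'k" where
  "canonical_embedding V x = (\<lambda>f. if f \<in> carr (dual V) then f x else 0)"

definition annihilator ::
    "('k::real_or_complex, 'v::ab_group_add) nspace \<Rightarrow> 'v set \<Rightarrow> ('v \<Rightarrow> 'k) set" where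
  "annihilator X J = {f \<in> carr (dual X). \<forall>y\<in>J. f y = 0}"

definition closed_subspace :: "('k, 'v::ab_group_add) nspace \<Rightarrow> 'v set \<Rightarrow> bool" where
  "closed_subspace X J \<longleftrightarrow>
     J \<subseteq> carr X \<and> 0 \<in> J \<and> (\<forall>x\<in>J. \<forall>y\<in>J. x + y \<in> J) \<and> (\<forall>c. \<forall>x\<in>J. smul X c x \<in> J) \<and>
     (\<forall>x\<in>carr X. (\<forall>e>0. \<exists>y\<in>J. nrm X (x - y) < e) \<longrightarrow> x \<in> J)"

definition HB_subspace :: "('k::real_or_complex, 'v::ab_group_add) nspace \<Rightarrow> 'v set \<Rightarrow> bool" where
  "HB_subspace X J \<longleftrightarrow>
     closed_subspace X J \<and>
     (\<exists>q. linear_between (dual X) (dual X) q \<and>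
          (\<forall>f\<in>carr (dual X). q (q f) = q f) \<and>
          {f \<in> carr (dual X). q f = 0} = annihilator X J \<and>
          (\<forall>f\<in>carr (dual X). f \<noteq> q f \<longrightarrow>
             nrm (dual X) (q f) < nrm (dual X) f \<and> nrm (dual X) (f - q f) \<le> nrm (dual X) f))"

definition quotient_mapping ::
    "('k::real_or_complex \<Rightarrow> 'e::banach \<Rightarrow> 'e) \<Rightarrow> ('k \<Rightarrow> 'f::banach \<Rightarrow> 'f) \<Rightarrow> ('e \<Rightarrow> 'f) \<Rightarrow> bool" where
  "quotient_mapping sE sF \<rho> \<longleftrightarrow>
     Vector_Spaces.linear sE sF \<rho> \<and> bounded_linear \<rho> \<and> \<rho> ` ball 0 1 = ball 0 1"


section \<open>Homogeneous polynomials\<close>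

text \<open>
  An \<open>n\<close>-linear map is encoded as a function of sequences that depends only on the
  first \<open>n\<close> entries.
\<close>

definition multilinear_map ::
    "nat \<Rightarrow> ('k::field \<Rightarrow> 'e::ab_group_add \<Rightarrow> 'e) \<Rightarrow> ('k \<Rightarrow> 'f::ab_group_add \<Rightarrow> 'f) \<Rightarrow>
     ((nat \<Rightarrow> 'e) \<Rightarrow> 'f) \<Rightarrow> bool" where
  "multilinear_map n sE sF A \<longleftrightarrow>
     (\<forall>v. \<forall>i<n. Vector_Spaces.linear sE sF (\<lambda>x. A (v(i := x)))) \<and>
     (\<forall>v w. (\<forall>i<n. v i = w i) \<longrightarrow> A v = A w)"

definition homogeneous_polynomial ::
    "nat \<Rightarrow> ('k::field \<Rightarrow> 'e::ab_group_add \<Rightarrow> 'e) \<Rightarrow> ('k \<Rightarrow> 'f::ab_group_add \<Rightarrow> 'f) \<Rightarrow>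
     ('e \<Rightarrow> 'f) \<Rightarrow> bool" where
  "homogeneous_polynomial n sE sF P \<longleftrightarrow>
     (\<exists>A. multilinear_map n sE sF A \<and> (\<forall>x. P x = A (\<lambda>_. x)))"

definition poly_space ::
    "nat \<Rightarrow> ('k::real_or_complex \<Rightarrow> 'e::banach \<Rightarrow> 'e) \<Rightarrow> ('k \<Rightarrow> 'f::banach \<Rightarrow> 'f) \<Rightarrow>
     ('k, 'e \<Rightarrow> 'f) nspace" where
  "poly_space n sE sF =
     \<lparr>carr = {P. homogeneous_polynomial n sE sF P \<and> continuous_on UNIV P},
      smul = (\<lambda>c P x. sF c (P x)),
      nrm = (\<lambda>P. SUP x\<in>cball 0 1. norm (P x))\<rparr>"

text \<open>
  Nets are rendered by filters: a net corresponds to the image of its tail filter, and every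
  proper filter arises in this way.
\<close>

definition weakly_tendsto ::
    "('k::real_or_complex \<Rightarrow> 'e::banach \<Rightarrow> 'e) \<Rightarrow> 'e \<Rightarrow> 'e filter \<Rightarrow> bool" where
  "weakly_tendsto sE x \<F> \<longleftrightarrow> (\<forall>\<phi>\<in>carr (dual (of_type sE)). (\<phi> \<longlongrightarrow> \<phi> x) \<F>)"

definition weakly_continuous_on_bounded ::
    "('k::real_or_complex \<Rightarrow> 'e::banach \<Rightarrow> 'e) \<Rightarrow> ('e \<Rightarrow> 'f::banach) \<Rightarrow> bool" where
  "weakly_continuous_on_bounded sE P \<longleftrightarrow>
     (\<forall>\<F> B x. bounded B \<longrightarrow> eventually (\<lambda>z. z \<in> B) \<F> \<longrightarrow> weakly_tendsto sE x \<F> \<longrightarrow>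
        (P \<longlongrightarrow> P x) \<F>)"

text \<open>It makes no difference whether the limit of the image net is prescribed.\<close>

lemma weakly_continuous_on_bounded_iff_convergent:
  "weakly_continuous_on_bounded sE P \<longleftrightarrow>
     (\<forall>\<F> B. bounded B \<longrightarrow> eventually (\<lambda>z. z \<in> B) \<F> \<longrightarrow> (\<exists>x. weakly_tendsto sE x \<F>) \<longrightarrow>
        (\<exists>y. (P \<longlongrightarrow> y) \<F>))" (is "_ \<longleftrightarrow> ?R")
proof
  assume "weakly_continuous_on_bounded sE P"
  then show ?R
    unfolding weakly_continuous_on_bounded_def by blast
next
  assume R: ?R
  show "weakly_continuous_on_bounded sE P"
    unfolding weakly_continuous_on_bounded_def
  proof (intro allI impI)
    fix \<F> B x
    assume B: "bounded B" "eventually (\<lambda>z. z \<in> B) \<F>" and x: "weakly_tendsto sE x \<F>"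
    let ?G = "sup \<F> (principal {x})"
    have pr: "(\<phi> \<longlongrightarrow> \<phi> x) (principal {x})" for \<phi> :: "'b \<Rightarrow> 'a"
      by (rule tendsto_eventually) (simp add: eventually_principal)
    have "bounded (insert x B)" "eventually (\<lambda>z. z \<in> insert x B) ?G"
      using B by (auto simp: eventually_sup eventually_principal elim: eventually_mono)
    moreover have "weakly_tendsto sE x ?G"
      using x pr unfolding weakly_tendsto_def by (blast intro: filterlim_sup)
    ultimately obtain y where y: "(P \<longlongrightarrow> y) ?G"
      using R by blast
    have yF: "(P \<longlongrightarrow> y) \<F>"
      by (rule filterlim_mono[OF y order_refl sup_ge1])
    have "(P \<longlongrightarrow> y) (principal {x})"
      by (rule filterlim_mono[OF y order_refl sup_ge2])
    moreover have "(P \<longlongrightarrow> P x) (principal {x})"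
      by (rule tendsto_eventually) (simp add: eventually_principal)
    ultimately have "y = P x"
      by (rule tendsto_unique[rotated]) (simp add: principal_eq_bot_iff)
    with yF show "(P \<longlongrightarrow> P x) \<F>" by simp
  qed
qed

definition wcont_polys ::
    "nat \<Rightarrow> ('k::real_or_complex \<Rightarrow> 'e::banach \<Rightarrow> 'e) \<Rightarrow> ('k \<Rightarrow> 'f::banach \<Rightarrow> 'f) \<Rightarrow>
     ('e \<Rightarrow> 'f) set" where
  "wcont_polys n sE sF = {P \<in> carr (poly_space n sE sF). weakly_continuous_on_bounded sE P}"

end

theory Submission
  imports Defs
begin

text \<open>
  Let \<open>J\<close> be the canonical embedding of \<open>F\<close> into \<open>F\<^sup>*\<^sup>*\<close> and \<open>\<pi>\<close> the canonical projection of
  \<open>F\<^sup>*\<^sup>*\<^sup>*\<close>: it restricts a functional \<open>\<phi>\<close> to \<open>F\<close> along \<open>J\<close> and lets the restriction act on \<open>F\<^sup>*\<^sup>*\<close>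
  by evaluation. Its kernel is the annihilator of \<open>F\<close>, and it is the projection that makes \<open>F\<close> an
  HB-subspace of \<open>F\<^sup>*\<^sup>*\<close>. Both norm conditions are transported from the polynomials.

  Fix \<open>Y\<close> in \<open>F\<^sup>*\<^sup>*\<close> of norm one. By Goldstine's theorem, and because \<open>\<rho>\<close> maps the open unit ball onto
  the open unit ball, \<open>Y\<close> is the weak* limit of \<open>\<rho> x\<close> along an ultrafilter \<open>U\<close> of points \<open>x\<close> of the
  unit ball of \<open>E\<close> (\<open>goldstine_ultrafilter\<close>). Along \<open>U\<close> every continuous polynomial \<open>P\<close> has a weak*
  limit in \<open>F\<^sup>*\<^sup>*\<close>, of norm at most that of \<open>P\<close>. This limit plays the part of the value at a point of
  \<open>E\<^sup>*\<^sup>*\<close> of the Aron-Berner extension of \<open>P\<close>, and its norm estimate is immediate. Applying \<open>\<phi>\<close> to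
  the limit gives a functional \<open>lift \<phi>\<close> on the polynomials whose norm is at most that of \<open>\<phi>\<close>.

  Let \<open>q\<close> be the given projection on the dual of the polynomial space.

  \<^item> A weakly continuous polynomial converges in norm along \<open>U\<close> (\<open>weakly_cauchy_convergence\<close>), so its
    limit lies in \<open>J F\<close>, where \<open>\<phi>\<close> and \<open>\<pi> \<phi>\<close> agree. Hence \<open>q (lift \<phi>) = q (lift (\<pi> \<phi>))\<close>.

  \<^item> The polynomials \<open>f (\<rho> x) ^ n y\<close> are weakly continuous and have the limits \<open>Y f ^ n J y\<close>, where
    \<open>\<bar>Y f\<bar>\<close> may be close to one. So a functional that agrees with \<open>lift (\<pi> \<phi>)\<close> on the weakly
    continuous polynomials has at least the norm of the restriction of \<open>\<phi>\<close> to \<open>F\<close>, which in turn is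
    at least the norm of \<open>lift (\<pi> \<phi>)\<close> (\<open>restriction_le_of_agree\<close>). Since \<open>q\<close> strictly decreases the
    norm of every functional that it moves, it fixes \<open>lift (\<pi> \<phi>)\<close>, and so \<open>q (lift \<phi>) = lift (\<pi> \<phi>)\<close>.

  \<^item> The polynomials \<open>f (\<rho> x) ^ (n - 1) \<rho> x\<close> have the limits \<open>Y f ^ (n - 1) Y\<close>. They show that the norm
    of \<open>lift \<phi> - lift (\<pi> \<phi>)\<close> is at least the modulus of \<open>(\<phi> - \<pi> \<phi>) Y\<close>.

  The two inequalities for \<open>lift \<phi>\<close> and \<open>q\<close> thus give those for \<open>\<phi>\<close> and \<open>\<pi>\<close>, when \<open>Y\<close> runs through the
  unit sphere. That \<open>F\<close> is closed in \<open>F\<^sup>*\<^sup>*\<close> is the Hahn-Banach theorem: \<open>J\<close> is isometric.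
\<close>

section \<open>Coordinates in the scalar field\<close>

text \<open>
  A real part \<open>R\<close> and an imaginary unit \<open>j\<close>, where \<open>j = 0\<close> if the field is real. The imaginary part of
  \<open>a\<close> is \<open>- R (j * a)\<close>, so that the same formulas serve both fields.
\<close>
lemma scalar_coordinates:
  obtains R :: "'k::real_or_complex \<Rightarrow> real" and j :: 'k where
    "\<And>a b. R (a + b) = R a + R b" "\<And>r a. R (of_real r * a) = r * R a"
    "\<And>a. \<bar>R a\<bar> \<le> norm a" "R 1 = 1"
    "\<And>a. a = of_real (R a) - j * of_real (R (j * a))"
    "j = 0 \<or> j * j = - 1" "norm j \<le> 1" "R j = 0"
proof -
  obtain h :: "'k \<Rightarrow> complex" where add: "\<And>a b. h (a + b) = h a + h b"
    and mult: "\<And>a b. h (a * b) = h a * h b" and nrm: "\<And>a. norm (h a) = norm a"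
    and rng: "range h = \<real> \<or> range h = UNIV"
    using real_or_complex_iso[where 'a='k] by blast
  have h0: "h 0 = 0"
    using nrm[of 0] by simp
  have minus: "h (- a) = - h a" for a
    using add[of a "- a"] h0 by (simp add: eq_neg_iff_add_eq_0 add.commute)
  have diff: "h (a - b) = h a - h b" for a b
    using add[of a "- b"] minus[of b] by simp
  have inj: "a = b" if "h a = h b" for a b
    using that diff[of a b] nrm[of "a - b"] by simp
  have h1: "h 1 = 1"
    using mult[of 1 1] nrm[of 1] by auto
  \<comment> \<open>A complex number is determined to be the real number \<open>r\<close> by its distances to \<open>0\<close> and \<open>1\<close>.\<close>
  have hreal: "h (of_real r) = of_real r" for r
  proof -
    let ?z = "h (of_real r)"
    have n0: "norm ?z = \<bar>r\<bar>"
      by (simp add: nrm)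
    have "norm (?z - 1) = norm (of_real (r - 1) :: 'k)"
      using diff[of "of_real r" 1] nrm[of "of_real r - 1"] h1 by simp
    then have n1: "norm (?z - 1) = \<bar>r - 1\<bar>"
      by (simp only: norm_of_real)
    have s0: "(Re ?z)\<^sup>2 + (Im ?z)\<^sup>2 = r\<^sup>2"
      using n0 by (metis cmod_power2 power2_abs)
    have "(Re ?z - 1)\<^sup>2 + (Im ?z)\<^sup>2 = (r - 1)\<^sup>2"
      using n1 cmod_power2[of "?z - 1"] by simp
    then have "Re ?z = r"
      using s0 by (simp add: power2_eq_square algebra_simps)
    then show ?thesis
      using s0 by (simp add: complex_eq_iff)
  qed
  define R where "R a = Re (h a)" for a
  have R: "R (a + b) = R a + R b" "R (of_real r * a) = r * R a" "\<bar>R a\<bar> \<le> norm a" "R 1 = 1"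
    for a b r
    using abs_Re_le_cmod[of "h a"] by (simp_all add: R_def add mult hreal h1 nrm)
  show thesis
  proof (cases "range h = \<real>")
    case True
    have "a = of_real (R a)" for a
    proof (rule inj)
      have "h a \<in> \<real>"
        using True by blast
      then show "h a = h (of_real (R a))"
        by (simp add: hreal R_def)
    qed
    then show ?thesis
      using that[of R 0] R by (simp add: R_def h0)
  next
    case False
    then obtain j where j: "h j = \<i>"
      using rng by (metis UNIV_I imageE)
    have "a = of_real (R a) - j * of_real (R (j * a))" for a
      by (rule inj) (simp add: add diff mult hreal R_def j complex_eq_iff)
    moreover have "j * j = - 1"
      by (rule inj) (simp add: mult minus j h1)
    moreover have "norm j \<le> 1"
      using nrm[of j] j by simp
    ultimately show ?thesis
      using that[of R j] R by (simp add: R_def j)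
  qed
qed

lemma compact_cball_scalar: "compact (cball (0::'k::real_or_complex) B)"
proof -
  obtain R :: "'k \<Rightarrow> real" and j :: 'k where R: "\<And>a. \<bar>R a\<bar> \<le> norm a"
    and eq: "\<And>a. a = of_real (R a) - j * of_real (R (j * a))" and j: "norm j \<le> 1"
    by (rule scalar_coordinates) blast
  let ?f = "\<lambda>p::real \<times> real. of_real (fst p) - j * of_real (snd p)"
  let ?K = "?f ` (cball 0 B \<times> cball 0 B)"
  have "compact ?K"
    by (intro compact_continuous_image continuous_intros compact_Times) auto
  moreover have "cball 0 B \<subseteq> ?K"
  proof
    fix a :: 'k
    assume "a \<in> cball 0 B"
    then have a: "norm a \<le> B"
      by simp
    have "norm (j * a) \<le> norm a"
      using mult_right_mono[OF j, of "norm a"] by (simp add: norm_mult)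
    then have "(R a, R (j * a)) \<in> cball 0 B \<times> cball 0 B"
      using R[of a] R[of "j * a"] a by simp
    then show "a \<in> ?K"
      using eq[of a] by (auto intro!: image_eqI[of _ _ "(R a, R (j * a))"])
  qed
  ultimately show ?thesis
    using compact_Int_closed[of ?K "cball 0 B"] by (simp add: Int_absorb1)
qed

section \<open>Ultrafilters\<close>

definition ultrafilter :: "'a filter \<Rightarrow> bool" where
  "ultrafilter U \<longleftrightarrow> U \<noteq> bot \<and> (\<forall>P. eventually P U \<or> eventually (\<lambda>x. \<not> P x) U)"

text \<open>
  A minimal proper filter decides every predicate: if \<open>P\<close> is compatible with it, then adding \<open>P\<close> gives
  a smaller proper filter, hence the same one.
\<close>
lemma ultrafilter_below:
  assumes "F \<noteq> bot"
  obtains U where "U \<le> F" "ultrafilter U"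
proof -
  let ?A = "{G. G \<le> F \<and> G \<noteq> bot}"
  have "\<exists>U\<in>?A. \<forall>G\<in>?A. G \<le> U \<longrightarrow> G = U"
  proof (rule predicate_Zorn)
    show "partial_order_on ?A (relation_of (\<lambda>G H. H \<le> G) ?A)"
      by (rule partial_order_on_relation_ofI) auto
    fix C
    assume "C \<in> Chains (relation_of (\<lambda>G H. H \<le> G) ?A)"
    then have C: "C \<subseteq> ?A" "\<And>G H. G \<in> C \<Longrightarrow> H \<in> C \<Longrightarrow> H \<le> G \<or> G \<le> H"
      unfolding Chains_def relation_of_def by auto
    show "\<exists>U\<in>?A. \<forall>G\<in>C. U \<le> G"
    proof (cases "C = {}")
      case True
      then show ?thesis
        using assms by auto
    next
      case False
      have "(INF G\<in>C. G) = bot \<longleftrightarrow> (\<exists>G\<in>C. G = bot)"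
        by (rule INF_filter_bot_base) (metis C(2) le_inf_iff)
      then have "Inf C \<noteq> bot"
        using C(1) by auto
      moreover have "Inf C \<le> F"
        using False C(1) by (auto intro: Inf_lower2)
      ultimately show ?thesis
        by (auto intro: Inf_lower)
    qed
  qed
  then obtain U where U0: "U \<in> ?A" "\<forall>G\<in>?A. G \<le> U \<longrightarrow> G = U"
    by (rule bexE)
  then have U: "U \<le> F" "U \<noteq> bot"
    by simp_all
  have min: "G = U" if "G \<le> U" "G \<noteq> bot" for G
    using U0(2) that order_trans[OF that(1) U(1)] by simp
  have "eventually P U \<or> eventually (\<lambda>x. \<not> P x) U" for P
  proof (cases "inf U (principal {x. P x}) = bot")
    case True
    then show ?thesis
      using eventually_inf_principal[of "\<lambda>_. False" U "{x. P x}"] by simp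
  next
    case False
    then have "inf U (principal {x. P x}) = U"
      by (rule min[OF inf_le1])
    then have "U \<le> principal {x. P x}"
      by (simp add: le_iff_inf)
    then show ?thesis
      by (simp add: le_principal)
  qed
  then show thesis
    using that U by (simp add: ultrafilter_def)
qed

lemma ultrafilter_compact_limit:
  assumes U: "ultrafilter U" and K: "compact K" and ev: "eventually (\<lambda>x. f x \<in> K) U"
  shows "\<exists>l\<in>K. (f \<longlongrightarrow> l) U"
proof -
  have "filtermap f U \<noteq> bot"
    using U by (simp add: ultrafilter_def filtermap_bot_iff)
  then obtain l where l: "l \<in> K" "inf (nhds l) (filtermap f U) \<noteq> bot"
    using compact_filter[THEN iffD1, OF K, rule_format, of "filtermap f U"] ev
    by (auto simp: eventually_filtermap)
  have "(f \<longlongrightarrow> l) U"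
  proof (rule topological_tendstoI, rule ccontr)
    fix S
    assume S: "open S" "l \<in> S" and "\<not> eventually (\<lambda>x. f x \<in> S) U"
    then have "eventually (\<lambda>y. y \<notin> S) (filtermap f U)"
      using U by (auto simp: ultrafilter_def eventually_filtermap)
    moreover have "eventually (\<lambda>y. y \<in> S) (nhds l)"
      using S by (rule eventually_nhds_in_open)
    ultimately have "eventually (\<lambda>y. False) (inf (nhds l) (filtermap f U))"
      unfolding eventually_inf by blast
    then show False
      using l(2) by (simp add: eventually_False)
  qed
  with l show ?thesis
    by blast
qed

section \<open>Real functionals dominated by the norm\<close>

definition sublinear :: "('a::real_vector \<Rightarrow> real) \<Rightarrow> bool" where
  "sublinear p \<longleftrightarrow> (\<forall>x y. p (x + y) \<le> p x + p y) \<and> (\<forall>c>0. \<forall>x. p (c *\<^sub>R x) \<le> c * p x)"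

lemma sublinear_add: "sublinear p \<Longrightarrow> p (x + y) \<le> p x + p y"
  by (simp add: sublinear_def)

lemma sublinear_scale_pos:
  assumes "sublinear p" "0 < c"
  shows "p (c *\<^sub>R x) = c * p x"
proof -
  have "p (inverse c *\<^sub>R c *\<^sub>R x) \<le> inverse c * p (c *\<^sub>R x)"
    using assms unfolding sublinear_def by (metis positive_imp_inverse_positive)
  then have "c * p x \<le> p (c *\<^sub>R x)"
    using assms(2) by (simp add: field_simps)
  then show ?thesis
    using assms unfolding sublinear_def by (simp add: order_antisym)
qed

lemma sublinear_zero:
  assumes "sublinear p"
  shows "p 0 = 0"
  using sublinear_scale_pos[OF assms, of 2 0] by simp

lemma sublinear_scale: "sublinear p \<Longrightarrow> 0 \<le> c \<Longrightarrow> p (c *\<^sub>R x) = c * p x"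
  by (cases "c = 0") (auto simp: sublinear_zero sublinear_scale_pos)

text \<open>
  The largest sublinear functional below \<open>p\<close> whose value at \<open>- y\<close> is at most \<open>- p y\<close>; it is linear
  along \<open>y\<close>.
\<close>
definition flatten :: "('a::real_vector \<Rightarrow> real) \<Rightarrow> 'a \<Rightarrow> 'a \<Rightarrow> real" where
  "flatten p y z = (INF t\<in>{0..}. p (z + t *\<^sub>R y) - t * p y)"

lemma flatten_le:
  assumes p: "sublinear p" and t: "0 \<le> t"
  shows "flatten p y z \<le> p (z + t *\<^sub>R y) - t * p y"
  unfolding flatten_def
proof (rule cINF_lower)
  show "bdd_below ((\<lambda>t. p (z + t *\<^sub>R y) - t * p y) ` {0..})"
  proof (rule bdd_belowI2)
    fix t :: real
    assume "t \<in> {0..}"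
    then have "t * p y = p (t *\<^sub>R y)"
      using sublinear_scale[OF p] by simp
    also have "\<dots> \<le> p (z + t *\<^sub>R y) + p (- z)"
      using sublinear_add[OF p, of "z + t *\<^sub>R y" "- z"] by simp
    finally show "- p (- z) \<le> p (z + t *\<^sub>R y) - t * p y"
      by simp
  qed
qed (use t in simp)

lemma flatten_greatest:
  "(\<And>t. 0 \<le> t \<Longrightarrow> m \<le> p (z + t *\<^sub>R y) - t * p y) \<Longrightarrow> m \<le> flatten p y z"
  unfolding flatten_def by (rule cINF_greatest) auto

lemma sublinear_flatten:
  assumes p: "sublinear p"
  shows "sublinear (flatten p y)"
  unfolding sublinear_def
proof (intro conjI allI impI)
  fix a b
  have "flatten p y (a + b) - flatten p y b \<le> p (a + s *\<^sub>R y) - s * p y" if s: "0 \<le> s" for s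
  proof -
    have "flatten p y (a + b) - (p (a + s *\<^sub>R y) - s * p y) \<le> p (b + t *\<^sub>R y) - t * p y"
      if t: "0 \<le> t" for t
      using flatten_le[OF p, of "s + t" y "a + b"] s t
        sublinear_add[OF p, of "a + s *\<^sub>R y" "b + t *\<^sub>R y"]
      by (simp add: algebra_simps)
    then have "flatten p y (a + b) - (p (a + s *\<^sub>R y) - s * p y) \<le> flatten p y b"
      by (rule flatten_greatest)
    then show ?thesis
      by simp
  qed
  then have "flatten p y (a + b) - flatten p y b \<le> flatten p y a"
    by (rule flatten_greatest)
  then show "flatten p y (a + b) \<le> flatten p y a + flatten p y b"
    by simp
next
  fix c :: real and z
  assume c: "0 < c"
  have "flatten p y (c *\<^sub>R z) / c \<le> p (z + t *\<^sub>R y) - t * p y" if t: "0 \<le> t" for t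
  proof -
    have "flatten p y (c *\<^sub>R z) \<le> p (c *\<^sub>R (z + t *\<^sub>R y)) - c * (t * p y)"
      using flatten_le[OF p, of "c * t" y "c *\<^sub>R z"] c t
      by (simp add: scaleR_add_right mult.assoc)
    also have "\<dots> = c * (p (z + t *\<^sub>R y) - t * p y)"
      by (simp only: sublinear_scale_pos[OF p c] right_diff_distrib)
    finally show ?thesis
      using c by (simp add: field_simps)
  qed
  then have "flatten p y (c *\<^sub>R z) / c \<le> flatten p y z"
    by (rule flatten_greatest)
  then show "flatten p y (c *\<^sub>R z) \<le> c * flatten p y z"
    using c by (simp add: field_simps)
qed

text \<open>
  The Hahn-Banach theorem by minimality. Lowering \<open>p\<close> by \<open>flatten\<close> in a direction \<open>y\<close> gives
  \<open>p z \<le> p (z + y) - p y\<close> when \<open>p\<close> is minimal among the admissible functionals, and with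
  subadditivity this is linearity. The condition at \<open>- x\<close> fixes the value at \<open>x\<close>; flattening the norm
  in the direction \<open>x\<close> shows that it can be met.
\<close>
lemma real_norming_functional:
  fixes x :: "'a::real_normed_vector"
  obtains u :: "'a \<Rightarrow> real" where "\<And>y z. u (y + z) = u y + u z" "\<And>c y. u (c *\<^sub>R y) = c * u y"
    "\<And>y. u y \<le> norm y" "u x = norm x"
proof -
  have norm: "sublinear (norm :: 'a \<Rightarrow> real)"
    by (simp add: sublinear_def norm_triangle_ineq)
  let ?A = "{p. sublinear p \<and> (\<forall>y. p y \<le> norm y) \<and> p (- x) \<le> - norm x}"
  have "\<exists>p\<in>?A. \<forall>r\<in>?A. r \<le> p \<longrightarrow> r = p"
  proof (rule predicate_Zorn)
    show "partial_order_on ?A (relation_of (\<lambda>p r. r \<le> p) ?A)"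
      by (rule partial_order_on_relation_ofI) auto
    fix C
    assume "C \<in> Chains (relation_of (\<lambda>p r. r \<le> p) ?A)"
    then have C: "C \<subseteq> ?A" "\<And>p r. p \<in> C \<Longrightarrow> r \<in> C \<Longrightarrow> r \<le> p \<or> p \<le> r"
      unfolding Chains_def relation_of_def by auto
    show "\<exists>u\<in>?A. \<forall>p\<in>C. u \<le> p"
    proof (cases "C = {}")
      case True
      have "flatten norm x \<in> ?A"
        using sublinear_flatten[OF norm] flatten_le[OF norm, of 0 x]
          flatten_le[OF norm, of 1 x "- x"] by simp
      then show ?thesis
        using True by blast
    next
      case False
      define m where "m y = (INF p\<in>C. p y)" for y
      have low: "m y \<le> p y" if "p \<in> C" for p y
        unfolding m_def
      proof (rule cINF_lower[OF _ that], rule bdd_belowI2)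
        fix r
        assume "r \<in> C"
        then have r: "sublinear r" "r (- y) \<le> norm y"
          using subsetD[OF C(1)] by (auto simp: norm_minus_cancel[of y, symmetric] simp del: norm_minus_cancel)
        show "- norm y \<le> r y"
          using sublinear_add[OF r(1), of y "- y"] sublinear_zero[OF r(1)] r(2) by simp
      qed
      have great: "b \<le> m y" if "\<And>p. p \<in> C \<Longrightarrow> b \<le> p y" for b y
        unfolding m_def by (rule cINF_greatest[OF False that])
      have "sublinear m"
        unfolding sublinear_def
      proof (intro conjI allI impI)
        fix a b
        have "m (a + b) - m b \<le> p a" if p: "p \<in> C" for p
        proof -
          have "m (a + b) - p a \<le> r b" if r: "r \<in> C" for r
          proof -
            obtain s where s: "s \<in> C" "s \<le> p" "s \<le> r"
              using C(2)[OF p r] p r by blast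
            have "m (a + b) \<le> s a + s b"
              using low[OF s(1), of "a + b"] subsetD[OF C(1) s(1)] sublinear_add[of s a b] by simp
            then show ?thesis
              using le_funD[OF s(2), of a] le_funD[OF s(3), of b] by linarith
          qed
          then have "m (a + b) - p a \<le> m b"
            by (rule great)
          then show ?thesis
            by simp
        qed
        then have "m (a + b) - m b \<le> m a"
          by (rule great)
        then show "m (a + b) \<le> m a + m b"
          by simp
      next
        fix c :: real and z
        assume c: "0 < c"
        have "m (c *\<^sub>R z) / c \<le> p z" if p: "p \<in> C" for p
        proof -
          have "sublinear p"
            using p C(1) by auto
          then show ?thesis
            using low[OF p, of "c *\<^sub>R z"] sublinear_scale_pos[of p c z] c by (simp add: field_simps)
        qed
        then have "m (c *\<^sub>R z) / c \<le> m z"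
          by (rule great)
        then show "m (c *\<^sub>R z) \<le> c * m z"
          using c by (simp add: field_simps)
      qed
      moreover obtain p where p: "p \<in> C"
        using False by blast
      then have "m y \<le> norm y" "m (- x) \<le> - norm x" for y
        using low[OF p, of y] low[OF p, of "- x"] subsetD[OF C(1) p] by (auto dest!: spec[of _ y])
      ultimately show ?thesis
        using low by (intro bexI[of _ m]) (auto intro: le_funI)
    qed
  qed
  then obtain p where p: "sublinear p" "\<And>y. p y \<le> norm y" "p (- x) \<le> - norm x"
    and min: "\<And>r. r \<in> ?A \<Longrightarrow> r \<le> p \<Longrightarrow> r = p"
    by auto
  have add: "p (z + y) = p z + p y" for y z
  proof -
    have le: "flatten p y \<le> p"
      using flatten_le[OF p(1), of 0 y] by (simp add: le_fun_def)
    then have "flatten p y = p"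
      using sublinear_flatten[OF p(1)] p(3) order_trans[OF le_funD[OF le] p(2)]
        order_trans[OF le_funD[OF le] p(3)] by (intro min) auto
    then have "p z \<le> p (z + y) - p y"
      using flatten_le[OF p(1), of 1 y z] by simp
    then show ?thesis
      using sublinear_add[OF p(1), of z y] by simp
  qed
  have neg: "p (- y) = - p y" for y
    using add[of y "- y"] sublinear_zero[OF p(1)] by simp
  have "p (c *\<^sub>R y) = c * p y" for c y
    using sublinear_scale[OF p(1), of c y] sublinear_scale[OF p(1), of "- c" y] neg[of "c *\<^sub>R y"]
    by (cases "0 \<le> c") simp_all
  moreover have "p x = norm x"
    using p(2)[of x] p(3) neg[of x] by simp
  ultimately show thesis
    using that[of p] add p(2) by blast
qed

section \<open>Normed carriers and their duals\<close>

lemma cSUP_mult_left: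
  fixes g :: "'i \<Rightarrow> real"
  assumes "S \<noteq> {}" "bdd_above (g ` S)" "0 \<le> c"
  shows "(SUP x\<in>S. c * g x) = c * (SUP x\<in>S. g x)"
proof -
  have "c * Sup (g ` S) = (SUP y\<in>g ` S. c * y)"
    using assms by (intro continuous_at_Sup_mono monoI mult_left_mono continuous_intros) auto
  then show ?thesis
    by (simp add: image_image)
qed

text \<open>
  The properties of a norm by which the dual norm bounds functionals at every point. They pass to the
  dual, so that the bidual and the third dual need no separate treatment.
\<close>
locale gauged_space =
  fixes V :: "('k::real_or_complex, 'v::ab_group_add) nspace"
  assumes zero_mem: "0 \<in> carr V"
    and add_mem: "x \<in> carr V \<Longrightarrow> y \<in> carr V \<Longrightarrow> x + y \<in> carr V"
    and smul_mem: "x \<in> carr V \<Longrightarrow> smul V c x \<in> carr V"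
    and nrm_nonneg: "x \<in> carr V \<Longrightarrow> 0 \<le> nrm V x"
    and nrm_smul: "x \<in> carr V \<Longrightarrow> nrm V (smul V c x) = norm c * nrm V x"

lemma carr_dual:
  "f \<in> carr (dual V) \<longleftrightarrow>
     (\<forall>x\<in>carr V. \<forall>y\<in>carr V. f (x + y) = f x + f y) \<and>
     (\<forall>c. \<forall>x\<in>carr V. f (smul V c x) = c * f x) \<and>
     (\<exists>B. \<forall>x\<in>carr V. norm (f x) \<le> B * nrm V x) \<and> (\<forall>x. x \<notin> carr V \<longrightarrow> f x = 0)"
  by (simp add: dual_def linear_between_def of_type_def)

lemma smul_dual [simp]: "smul (dual V) c f = (\<lambda>x. c * f x)"
  by (simp add: dual_def)

lemma of_type_simps [simp]: "carr (of_type s) = UNIV" "smul (of_type s) = s" "nrm (of_type s) = norm"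
  by (simp_all add: of_type_def)

lemma dual_memI:
  assumes "\<And>x y. x \<in> carr V \<Longrightarrow> y \<in> carr V \<Longrightarrow> f (x + y) = f x + f y"
    and "\<And>c x. x \<in> carr V \<Longrightarrow> f (smul V c x) = c * f x"
    and "\<And>x. x \<in> carr V \<Longrightarrow> norm (f x) \<le> B * nrm V x"
    and "\<And>x. x \<notin> carr V \<Longrightarrow> f x = 0"
  shows "f \<in> carr (dual V)"
  using assms unfolding carr_dual by blast

lemma dual_add: "f \<in> carr (dual V) \<Longrightarrow> x \<in> carr V \<Longrightarrow> y \<in> carr V \<Longrightarrow> f (x + y) = f x + f y"
  by (simp add: carr_dual)

lemma dual_smul: "f \<in> carr (dual V) \<Longrightarrow> x \<in> carr V \<Longrightarrow> f (smul V c x) = c * f x"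
  by (simp add: carr_dual)

lemma dual_outside: "f \<in> carr (dual V) \<Longrightarrow> x \<notin> carr V \<Longrightarrow> f x = 0"
  by (simp add: carr_dual)

lemma canonical_embedding_apply: "f \<in> carr (dual V) \<Longrightarrow> canonical_embedding V x f = f x"
  by (simp add: canonical_embedding_def)

context gauged_space begin

lemma dual_zero: "f \<in> carr (dual V) \<Longrightarrow> f 0 = 0"
  using dual_add[of f V 0 0] zero_mem by simp

lemma zero_gauge: "nrm V (smul V 0 0) = 0"
  using nrm_smul[OF zero_mem, of 0] by simp

lemma dual_nrm_leI:
  assumes "\<And>x. x \<in> carr V \<Longrightarrow> nrm V x \<le> 1 \<Longrightarrow> norm (f x) \<le> B"
  shows "nrm (dual V) f \<le> B"
proof -
  have "(SUP x\<in>{x \<in> carr V. nrm V x \<le> 1}. norm (f x)) \<le> B"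
    using assms zero_gauge smul_mem[OF zero_mem, of 0] by (intro cSUP_least) auto
  then show ?thesis
    by (simp add: dual_def)
qed

lemma dual_bdd_above:
  assumes f: "f \<in> carr (dual V)"
  shows "bdd_above ((\<lambda>x. norm (f x)) ` {x \<in> carr V. nrm V x \<le> 1})"
proof -
  obtain B where B: "\<And>x. x \<in> carr V \<Longrightarrow> norm (f x) \<le> B * nrm V x"
    using f unfolding carr_dual by blast
  show ?thesis
  proof (rule bdd_aboveI2)
    fix x
    assume x: "x \<in> {x \<in> carr V. nrm V x \<le> 1}"
    have "norm (f x) \<le> \<bar>B\<bar> * nrm V x"
      using B[of x] x mult_right_mono[OF abs_ge_self, of "nrm V x" B] nrm_nonneg[of x] by auto
    also have "\<dots> \<le> \<bar>B\<bar> * 1"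
      using x by (intro mult_left_mono) auto
    finally show "norm (f x) \<le> \<bar>B\<bar>"
      by simp
  qed
qed

lemma dual_le_nrm:
  assumes f: "f \<in> carr (dual V)" and x: "x \<in> carr V" "nrm V x \<le> 1"
  shows "norm (f x) \<le> nrm (dual V) f"
proof -
  have "norm (f x) \<le> (SUP x\<in>{x \<in> carr V. nrm V x \<le> 1}. norm (f x))"
    using x dual_bdd_above[OF f] by (intro cSUP_upper) auto
  then show ?thesis
    by (simp add: dual_def)
qed

lemma dual_nrm_nonneg: "f \<in> carr (dual V) \<Longrightarrow> 0 \<le> nrm (dual V) f"
  using dual_le_nrm[of f "smul V 0 0"] zero_gauge smul_mem[OF zero_mem, of 0]
    order_trans[OF norm_ge_zero, of "f (smul V 0 0)"] by simp

lemma unit_multiple: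
  assumes "x \<in> carr V" "nrm V x \<noteq> 0"
  shows "nrm V (smul V (of_real (1 / nrm V x)) x) = 1"
  using assms nrm_nonneg[of x] by (simp add: nrm_smul norm_divide)

lemma dual_bound:
  assumes f: "f \<in> carr (dual V)" and x: "x \<in> carr V"
  shows "norm (f x) \<le> nrm (dual V) f * nrm V x"
proof (cases "nrm V x = 0")
  case True
  then show ?thesis
    using f x unfolding carr_dual by (metis mult_zero_right)
next
  case False
  then have pos: "0 < nrm V x"
    using nrm_nonneg[OF x] by simp
  have "norm (f (smul V (of_real (1 / nrm V x)) x)) \<le> nrm (dual V) f"
    using unit_multiple[OF x False] by (intro dual_le_nrm[OF f smul_mem[OF x]]) simp
  then show ?thesis
    using pos unfolding dual_smul[OF f x]
    by (simp add: norm_mult norm_divide field_simps)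
qed

lemma dual_memI_bound_one:
  assumes "f \<in> carr (dual V)" "nrm (dual V) f \<le> 1" "x \<in> carr V"
  shows "norm (f x) \<le> nrm V x"
  using dual_bound[OF assms(1,3)] mult_right_mono[OF assms(2) nrm_nonneg[OF assms(3)]] by simp

lemma gauged_dual: "gauged_space (dual V)"
proof
  show "0 \<in> carr (dual V)"
    by (rule dual_memI[of _ _ 0]) auto
  fix f g :: "'v \<Rightarrow> 'k" and c :: 'k
  assume f: "f \<in> carr (dual V)"
  show "f + g \<in> carr (dual V)" if g: "g \<in> carr (dual V)"
  proof (rule dual_memI[of _ _ "nrm (dual V) f + nrm (dual V) g"])
    fix x
    assume x: "x \<in> carr V"
    show "norm ((f + g) x) \<le> (nrm (dual V) f + nrm (dual V) g) * nrm V x"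
      using norm_triangle_ineq[of "f x" "g x"] dual_bound[OF f x] dual_bound[OF g x]
      by (simp add: algebra_simps)
  qed (use f g in \<open>auto simp: dual_add dual_smul dual_outside algebra_simps\<close>)
  show "smul (dual V) c f \<in> carr (dual V)"
  proof (rule dual_memI[of _ _ "norm c * nrm (dual V) f"])
    fix x
    assume x: "x \<in> carr V"
    show "norm (smul (dual V) c f x) \<le> norm c * nrm (dual V) f * nrm V x"
      using mult_left_mono[OF dual_bound[OF f x], of "norm c"] by (simp add: norm_mult mult.assoc)
  qed (use f in \<open>auto simp: dual_add dual_smul dual_outside algebra_simps\<close>)
  show "0 \<le> nrm (dual V) f"
    by (rule dual_nrm_nonneg[OF f])
  have "smul V 0 0 \<in> {x \<in> carr V. nrm V x \<le> 1}"
    using zero_gauge smul_mem[OF zero_mem] by simp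
  then show "nrm (dual V) (smul (dual V) c f) = norm c * nrm (dual V) f"
    using cSUP_mult_left[OF _ dual_bdd_above[OF f], of "norm c"] by (auto simp: dual_def norm_mult)
qed

lemma dual_diff_mem:
  assumes f: "f \<in> carr (dual V)" and g: "g \<in> carr (dual V)"
  shows "f - g \<in> carr (dual V)"
proof -
  interpret D: gauged_space "dual V"
    by (rule gauged_dual)
  have "f - g = f + smul (dual V) (- 1) g"
    by (auto simp: fun_eq_iff)
  then show ?thesis
    using D.add_mem[OF f D.smul_mem[OF g]] by metis
qed

lemma canonical_embedding_mem:
  assumes x: "x \<in> carr V"
  shows "canonical_embedding V x \<in> carr (dual (dual V))"
proof -
  interpret D: gauged_space "dual V"
    by (rule gauged_dual)
  show ?thesis
  proof (rule dual_memI[of _ _ "nrm V x"])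
    show "canonical_embedding V x (f + g) = canonical_embedding V x f + canonical_embedding V x g"
      if "f \<in> carr (dual V)" "g \<in> carr (dual V)" for f g
      using that by (simp add: canonical_embedding_apply D.add_mem)
    show "canonical_embedding V x (smul (dual V) c f) = c * canonical_embedding V x f"
      if "f \<in> carr (dual V)" for c f
      using that D.smul_mem[of f c] by (simp add: canonical_embedding_apply)
    show "norm (canonical_embedding V x f) \<le> nrm V x * nrm (dual V) f"
      if "f \<in> carr (dual V)" for f
      using dual_bound[OF that x] that by (simp add: canonical_embedding_apply mult.commute)
  qed (simp add: canonical_embedding_def)
qed

lemma nrm_canonical_embedding_le:
  assumes x: "x \<in> carr V"
  shows "nrm (dual (dual V)) (canonical_embedding V x) \<le> nrm V x"
proof -
  interpret D: gauged_space "dual V"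
    by (rule gauged_dual)
  show ?thesis
    using dual_memI_bound_one[OF _ _ x] by (intro D.dual_nrm_leI) (simp add: canonical_embedding_apply)
qed

lemma dual_sum:
  assumes "finite X" "X \<subseteq> carr (dual V)"
  shows "(\<lambda>x. \<Sum>f\<in>X. c f * f x) \<in> carr (dual V)"
    and "Y \<in> carr (dual (dual V)) \<Longrightarrow> Y (\<lambda>x. \<Sum>f\<in>X. c f * f x) = (\<Sum>f\<in>X. c f * Y f)"
proof -
  interpret D: gauged_space "dual V"
    by (rule gauged_dual)
  have "(\<lambda>x. \<Sum>f\<in>X. c f * f x) \<in> carr (dual V) \<and>
    (Y \<in> carr (dual (dual V)) \<longrightarrow> Y (\<lambda>x. \<Sum>f\<in>X. c f * f x) = (\<Sum>f\<in>X. c f * Y f))"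
    using assms
  proof (induction X rule: finite_induct)
    case empty
    then show ?case
      using D.zero_mem D.dual_zero[of Y] by (simp add: zero_fun_def)
  next
    case (insert a X)
    let ?g = "\<lambda>x. \<Sum>f\<in>X. c f * f x"
    have a: "a \<in> carr (dual V)" and IH: "?g \<in> carr (dual V)"
      "Y \<in> carr (dual (dual V)) \<longrightarrow> Y ?g = (\<Sum>f\<in>X. c f * Y f)"
      using insert by simp_all
    have eq: "(\<lambda>x. \<Sum>f\<in>insert a X. c f * f x) = smul (dual V) (c a) a + ?g"
      using insert(1,2) by (simp add: fun_eq_iff)
    show ?case
      unfolding eq using insert(1,2) IH D.add_mem[OF D.smul_mem[OF a] IH(1)]
        dual_add[OF _ D.smul_mem[OF a] IH(1), of Y] dual_smul[OF _ a, of Y "c a"] by auto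
  qed
  then show "(\<lambda>x. \<Sum>f\<in>X. c f * f x) \<in> carr (dual V)"
    and "Y \<in> carr (dual (dual V)) \<Longrightarrow> Y (\<lambda>x. \<Sum>f\<in>X. c f * f x) = (\<Sum>f\<in>X. c f * Y f)"
    by blast+
qed

end

lemma canonical_embedding_linear:
  assumes "gauged_space V"
  shows "linear_between V (dual (dual V)) (canonical_embedding V)"
  using gauged_space.canonical_embedding_mem[OF assms]
  by (auto simp: linear_between_def canonical_embedding_def fun_eq_iff dual_add dual_smul)

lemma gauged_of_type:
  assumes "banach_over s"
  shows "gauged_space (of_type s)"
proof -
  interpret banach_over s
    by (rule assms)
  show ?thesis
    by unfold_locales (simp_all add: norm_scale)
qed

lemma rotation:
  fixes w :: "'k::real_normed_field"
  obtains c :: 'k where "norm c = 1" "c * w = of_real (norm w)"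
proof (cases "w = 0")
  case True
  then show ?thesis
    using that[of 1] by simp
next
  case False
  then show ?thesis
    using that[of "of_real (norm w) / w"] by (simp add: norm_divide)
qed

text \<open>
  A complex functional is recovered from its real part \<open>u\<close> as \<open>y \<mapsto> u y - \<i> u (\<i> y)\<close>.
\<close>
lemma norming_functional:
  fixes s :: "'k::real_or_complex \<Rightarrow> 'a::banach \<Rightarrow> 'a"
  assumes "banach_over s"
  obtains f where "f \<in> carr (dual (of_type s))" "nrm (dual (of_type s)) f \<le> 1"
    "norm (f x) = norm x"
proof -
  interpret banach_over s
    by (rule assms)
  interpret V: gauged_space "of_type s"
    by (rule gauged_of_type[OF assms])
  obtain R :: "'k \<Rightarrow> real" and j :: 'k where R: "\<And>a b. R (a + b) = R a + R b"
    "\<And>r a. R (of_real r * a) = r * R a" "\<And>a. \<bar>R a\<bar> \<le> norm a" "R 1 = 1"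
    and eq: "\<And>a. a = of_real (R a) - j * of_real (R (j * a))"
    and j: "j = 0 \<or> j * j = - 1" "R j = 0"
    by (rule scalar_coordinates) blast
  obtain u :: "'a \<Rightarrow> real" where u: "\<And>y z. u (y + z) = u y + u z" "\<And>c y. u (c *\<^sub>R y) = c * u y"
    "\<And>y. u y \<le> norm y" "u x = norm x"
    by (rule real_norming_functional[of x]) blast
  \<comment> \<open>The functional with real part \<open>u\<close>; \<open>j\<close> is \<open>0\<close> in the real case, so that nothing is added there.\<close>
  define f where "f y = of_real (u y) - j * of_real (u (s j y))" for y
  have u_neg: "u (- y) = - u y" for y
    using u(2)[of "- 1" y] by simp
  have f_add: "f (y + z) = f y + f z" for y z
    by (simp add: f_def u(1) algebra_simps)
  have f_real: "f (s (of_real r) y) = of_real r * f y" for r y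
  proof -
    have "s j (r *\<^sub>R y) = r *\<^sub>R s j y"
      using scale_left_commute[of j "of_real r" y] by (simp only: scale_of_real)
    then show ?thesis
      by (simp add: f_def scale_of_real u(2) algebra_simps)
  qed
  have f_j: "f (s j y) = j * f y" for y
    using j(1)
  proof
    assume "j = 0"
    moreover have "u 0 = 0"
      using u(2)[of 0 0] by simp
    ultimately show ?thesis
      by (simp add: f_def)
  next
    assume jj: "j * j = - 1"
    have "j * (j * a) = - a" for a
      by (simp add: jj mult.assoc[symmetric])
    from this[of "of_real (u (s j y))"] show ?thesis
      by (simp add: f_def jj u_neg right_diff_distrib)
  qed
  have f_scale: "f (s c y) = c * f y" for c y
  proof -
    let ?a = "R c" and ?b = "- R (j * c)"
    have c: "c = of_real ?a + of_real ?b * j"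
      using eq[of c] by (simp add: mult.commute)
    have "f (s c y) = f (s (of_real ?a) y + s (of_real ?b) (s j y))"
      by (subst c) (simp only: scale_left_distrib scale_scale)
    also have "\<dots> = (of_real ?a + of_real ?b * j) * f y"
      by (simp only: f_add f_real f_j) (simp add: algebra_simps)
    finally show ?thesis
      using c by simp
  qed
  have Rf: "R (f y) = u y" for y
  proof -
    have "R (of_real r) = r" for r
      using R(2)[of r 1] R(4) by simp
    moreover have "R (a - b) = R a - R b" for a b
      using R(1)[of "a - b" b] by simp
    moreover have "R (j * of_real r) = 0" for r
      using R(2)[of r j] j(2) by (simp add: mult.commute)
    ultimately show ?thesis
      by (simp add: f_def)
  qed
  have bound: "norm (f y) \<le> norm y" for y
  proof -
    obtain c where c: "norm c = 1" "c * f y = of_real (norm (f y))"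
      by (rule rotation[of "f y"])
    have "norm (f y) = R (of_real (norm (f y)))"
      using R(2)[of _ 1] R(4) by simp
    also have "\<dots> = u (s c y)"
      by (simp flip: c(2) f_scale Rf)
    also have "\<dots> \<le> norm y"
      using u(3)[of "s c y"] c(1) by (simp add: norm_scale)
    finally show ?thesis .
  qed
  have "f \<in> carr (dual (of_type s))"
    by (rule dual_memI[of _ _ 1]) (simp_all add: f_add f_scale bound)
  moreover have "nrm (dual (of_type s)) f \<le> 1"
    using bound by (intro V.dual_nrm_leI) (auto intro: order_trans)
  moreover have "norm (f x) = norm x"
    using bound[of x] R(3)[of "f x"] by (simp add: Rf u(4))
  ultimately show thesis
    by (rule that)
qed

section \<open>A Banach space is closed in its bidual\<close>

text \<open>
  Norming functionals make the embedding isometric, so elements whose images approximate a point of the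
  bidual form a Cauchy sequence.
\<close>
lemma closed_range_canonical_embedding:
  fixes s :: "'k::real_or_complex \<Rightarrow> 'a::banach \<Rightarrow> 'a"
  assumes "banach_over s"
  shows "closed_subspace (dual (dual (of_type s))) (range (canonical_embedding (of_type s)))"
proof -
  interpret banach_over s
    by (rule assms)
  interpret V: gauged_space "of_type s"
    by (rule gauged_of_type[OF assms])
  interpret D: gauged_space "dual (of_type s)"
    by (rule V.gauged_dual)
  interpret B: gauged_space "dual (dual (of_type s))"
    by (rule D.gauged_dual)
  let ?V = "of_type s" and ?J = "canonical_embedding (of_type s)"
  have J: "?J x \<in> carr (dual (dual ?V))" for x
    by (rule V.canonical_embedding_mem) simp
  have lin: "linear_between ?V (dual (dual ?V)) ?J"
    by (rule canonical_embedding_linear[OF V.gauged_space_axioms])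
  have J_add: "?J x + ?J y = ?J (x + y)" and J_scale: "smul (dual (dual ?V)) c (?J x) = ?J (s c x)"
    for x y c
    using lin by (simp_all add: linear_between_def)
  have J_zero: "?J 0 = 0"
    using J_add[of 0 0] by simp
  have lim: "Y \<in> range ?J" if Y: "Y \<in> carr (dual (dual ?V))"
    and close: "\<forall>e>0. \<exists>y\<in>range ?J. nrm (dual (dual ?V)) (Y - y) < e" for Y
  proof -
    have "\<forall>n. \<exists>x. nrm (dual (dual ?V)) (Y - ?J x) < inverse (real (Suc n))"
      using close by (metis imageE inverse_positive_iff_positive of_nat_0_less_iff zero_less_Suc)
    then obtain x where x: "\<And>n. nrm (dual (dual ?V)) (Y - ?J (x n)) < inverse (real (Suc n))"
      by metis
    have appr: "norm (Y f - f (x n)) \<le> inverse (real (Suc n)) * nrm (dual ?V) f"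
      if f: "f \<in> carr (dual ?V)" for f n
    proof -
      have "norm ((Y - ?J (x n)) f) \<le> nrm (dual (dual ?V)) (Y - ?J (x n)) * nrm (dual ?V) f"
        by (rule D.dual_bound[OF D.dual_diff_mem[OF Y J] f])
      also have "\<dots> \<le> inverse (real (Suc n)) * nrm (dual ?V) f"
        using x[of n] D.nrm_nonneg[OF f] by (intro mult_right_mono) auto
      finally show ?thesis
        using f by (simp add: canonical_embedding_apply)
    qed
    have dist: "norm (x m - x n) \<le> inverse (real (Suc m)) + inverse (real (Suc n))" for m n
    proof -
      obtain f where f: "f \<in> carr (dual ?V)" "nrm (dual ?V) f \<le> 1"
        "norm (f (x m - x n)) = norm (x m - x n)"
        by (rule norming_functional[OF assms])
      have one: "norm (Y f - f (x k)) \<le> inverse (real (Suc k))" for k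
        using order_trans[OF appr[OF f(1), of k] mult_left_mono[OF f(2)]] by simp
      have "f (x m - x n) + f (x n) = f (x m)"
        using dual_add[OF f(1), of "x m - x n" "x n"] by simp
      then have "f (x m - x n) = (Y f - f (x n)) - (Y f - f (x m))"
        by (simp add: algebra_simps)
      then show ?thesis
        using norm_triangle_ineq4[of "Y f - f (x n)" "Y f - f (x m)"] one[of m] one[of n] f(3)
        by simp
    qed
    have "Cauchy x"
    proof (rule metric_CauchyI)
      fix e :: real
      assume "0 < e"
      then obtain M where M: "inverse (real (Suc M)) < e / 2"
        using reals_Archimedean[of "e / 2"] by auto
      have "dist (x m) (x n) < e" if "m \<ge> M" "n \<ge> M" for m n
      proof -
        have "inverse (real (Suc m)) \<le> inverse (real (Suc M))"
          "inverse (real (Suc n)) \<le> inverse (real (Suc M))"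
          using that by (auto intro: le_imp_inverse_le)
        then show ?thesis
          using dist[of m n] M unfolding dist_norm by linarith
      qed
      then show "\<exists>M. \<forall>m\<ge>M. \<forall>n\<ge>M. dist (x m) (x n) < e"
        by blast
    qed
    then obtain z where z: "x \<longlonglongrightarrow> z"
      using Cauchy_convergent convergent_def by blast
    have "Y f = ?J z f" for f
    proof (cases "f \<in> carr (dual ?V)")
      case True
      have "(\<lambda>n. f (x n) - f z) \<longlonglongrightarrow> 0"
      proof (rule Lim_null_comparison)
        show "\<forall>\<^sub>F n in sequentially. norm (f (x n) - f z) \<le> nrm (dual ?V) f * norm (x n - z)"
        proof (rule always_eventually, rule allI)
          fix n
          have "f (x n - z) + f z = f (x n)"
            using dual_add[OF True, of "x n - z" z] by simp
          then have "f (x n) - f z = f (x n - z)"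
            by (simp add: algebra_simps)
          then show "norm (f (x n) - f z) \<le> nrm (dual ?V) f * norm (x n - z)"
            using V.dual_bound[OF True, of "x n - z"] by simp
        qed
        have "(\<lambda>n. x n - z) \<longlonglongrightarrow> 0"
          using z by (simp add: LIM_zero)
        then show "(\<lambda>n. nrm (dual ?V) f * norm (x n - z)) \<longlonglongrightarrow> 0"
          by (intro tendsto_mult_right_zero tendsto_norm_zero)
      qed
      then have fz: "(\<lambda>n. f (x n)) \<longlonglongrightarrow> f z"
        by (simp add: LIM_zero_iff)
      have "(\<lambda>n. Y f - f (x n)) \<longlonglongrightarrow> 0"
      proof (rule Lim_null_comparison)
        show "\<forall>\<^sub>F n in sequentially.
            norm (Y f - f (x n)) \<le> inverse (real (Suc n)) * nrm (dual ?V) f"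
          using appr[OF True] by simp
        show "(\<lambda>n. inverse (real (Suc n)) * nrm (dual ?V) f) \<longlonglongrightarrow> 0"
          by (rule tendsto_mult_left_zero[OF LIMSEQ_inverse_real_of_nat])
      qed
      then have "(\<lambda>n. f (x n)) \<longlonglongrightarrow> Y f"
        using tendsto_diff[OF tendsto_const[of "Y f"]] by fastforce
      then show ?thesis
        using LIMSEQ_unique[OF fz] True by (simp add: canonical_embedding_apply)
    next
      case False
      then show ?thesis
        using dual_outside[OF Y] by (simp add: canonical_embedding_def)
    qed
    then show ?thesis
      by blast
  qed
  show ?thesis
    unfolding closed_subspace_def
  proof (intro conjI ballI allI impI)
    show "range ?J \<subseteq> carr (dual (dual ?V))"
      using J by blast
    show "0 \<in> range ?J"
      by (rule range_eqI) (rule J_zero[symmetric])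
    show "a + b \<in> range ?J" if "a \<in> range ?J" "b \<in> range ?J" for a b
      using that J_add by auto
    show "smul (dual (dual ?V)) c a \<in> range ?J" if "a \<in> range ?J" for c a
      using that by (auto simp: J_scale simp del: smul_dual)
  qed (rule lim)
qed

section \<open>Weak* approximation in the bidual\<close>

lemma quadratic_sum_expand:
  fixes r d :: "'i \<Rightarrow> real"
  shows "(\<Sum>i\<in>X. (r i + t * d i)\<^sup>2) = (\<Sum>i\<in>X. (r i)\<^sup>2) + 2 * t * (\<Sum>i\<in>X. r i * d i) + t\<^sup>2 * (\<Sum>i\<in>X. (d i)\<^sup>2)"
  by (simp add: power2_sum sum.distrib sum_distrib_left algebra_simps)

text \<open>
  Least squares. Let \<open>r\<close> be the vector of residuals at a near-minimiser \<open>y\<close> of the sum \<open>N\<close> of their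
  squares over the open unit ball. Moving from \<open>y\<close> towards any other point of the ball does not lower
  \<open>N\<close> noticeably, which says that the functional \<open>g = - (\<Sum>f\<in>X. r f * f)\<close> almost attains its norm at
  \<open>y\<close>. Since \<open>Y\<close> has norm at most one, \<open>R (Y g)\<close> cannot exceed \<open>R (g y)\<close> by much; but the difference
  is exactly \<open>N y\<close>.
\<close>
lemma goldstine_real_parts:
  fixes s :: "'k::real_or_complex \<Rightarrow> 'a::banach \<Rightarrow> 'a" and R :: "'k \<Rightarrow> real"
  assumes s: "banach_over s"
    and R: "\<And>a b. R (a + b) = R a + R b" "\<And>r a. R (of_real r * a) = r * R a"
      "\<And>a. \<bar>R a\<bar> \<le> norm a" "R 1 = 1"
    and Y: "Y \<in> carr (dual (dual (of_type s)))" "nrm (dual (dual (of_type s))) Y \<le> 1"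
    and X: "finite X" "X \<subseteq> carr (dual (of_type s))" and e: "0 < e"
  shows "\<exists>y. norm y < 1 \<and> (\<forall>f\<in>X. \<bar>R (f y) - R (Y f)\<bar> < e)"
proof -
  interpret banach_over s
    by (rule s)
  interpret V: gauged_space "of_type s"
    by (rule gauged_of_type[OF s])
  interpret D: gauged_space "dual (of_type s)"
    by (rule V.gauged_dual)
  let ?V = "of_type s"
  define r where "r y f = R (f y) - R (Y f)" for y f
  define N where "N y = (\<Sum>f\<in>X. (r y f)\<^sup>2)" for y
  define M where "M = (\<Sum>f\<in>X. (2 * nrm (dual ?V) f)\<^sup>2)"
  have R_sum: "R (\<Sum>f\<in>A. g f) = (\<Sum>f\<in>A. R (g f))" for g :: "('a \<Rightarrow> 'k) \<Rightarrow> 'k" and A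
  proof -
    have "R 0 = 0"
      using R(2)[of 0 0] by simp
    then show ?thesis
      by (induction A rule: infinite_finite_induct) (auto simp: R(1))
  qed
  have M0: "0 \<le> M"
    unfolding M_def by (intro sum_nonneg) simp
  \<comment> \<open>Step length of the variation; a minimum that is accurate up to \<open>t\<^sup>2\<close> matches its quadratic term.\<close>
  define t where "t = min 1 (e\<^sup>2 / (1 + M))"
  have "t \<le> e\<^sup>2 / (1 + M)"
    by (simp add: t_def)
  then have "t * (1 + M) \<le> e\<^sup>2"
    using M0 by (simp add: pos_le_divide_eq)
  then have t: "0 < t" "t \<le> 1" "t * (1 + M) \<le> e\<^sup>2"
    using e M0 by (simp_all add: t_def)
  let ?d = "INF y\<in>ball 0 1. N y"
  have bdd: "bdd_below (N ` ball 0 1)"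
    by (rule bdd_belowI2[of _ 0]) (simp add: N_def sum_nonneg)
  have "\<exists>y\<in>ball 0 1. N y < ?d + t\<^sup>2"
    using cINF_less_iff[OF _ bdd, of "?d + t\<^sup>2"] t(1) by simp
  then obtain y where y: "norm y < 1" "N y < ?d + t\<^sup>2"
    by auto
  have var: "- (t * (1 + M) / 2) \<le> (\<Sum>f\<in>X. r y f * (R (f z) - R (f y)))" if z: "norm z < 1" for z
  proof -
    let ?w = "(1 - t) *\<^sub>R y + t *\<^sub>R z" and ?\<delta> = "\<lambda>f. R (f z) - R (f y)"
    have "norm ?w \<le> (1 - t) * norm y + t * norm z"
      using t norm_triangle_ineq[of "(1 - t) *\<^sub>R y" "t *\<^sub>R z"] by simp
    also have "\<dots> < 1"
      using t y(1) z by (intro convex_bound_lt) auto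
    finally have w: "?w \<in> ball 0 1"
      by simp
    have step: "r ?w f = r y f + t * ?\<delta> f" if f: "f \<in> X" for f
    proof -
      have f: "f \<in> carr (dual ?V)"
        using X f by blast
      have "f (c *\<^sub>R x) = of_real c * f x" for c x
        using dual_smul[OF f, of x "of_real c"] by (simp add: scale_of_real)
      then have "f ?w = of_real (1 - t) * f y + of_real t * f z"
        using dual_add[OF f, of "(1 - t) *\<^sub>R y" "t *\<^sub>R z"] by simp
      then have "R (f ?w) = (1 - t) * R (f y) + t * R (f z)"
        by (simp only: R)
      then show ?thesis
        by (simp add: r_def algebra_simps)
    qed
    have "?d \<le> N ?w"
      by (rule cINF_lower[OF bdd w])
    also have "N ?w = N y + 2 * t * (\<Sum>f\<in>X. r y f * ?\<delta> f) + t\<^sup>2 * (\<Sum>f\<in>X. (?\<delta> f)\<^sup>2)"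
      unfolding N_def quadratic_sum_expand[symmetric] by (rule sum.cong) (simp_all add: step)
    also have "(\<Sum>f\<in>X. (?\<delta> f)\<^sup>2) \<le> M"
      unfolding M_def
    proof (rule sum_mono)
      fix f
      assume "f \<in> X"
      then have f: "f \<in> carr (dual ?V)"
        using X by blast
      have "\<bar>?\<delta> f\<bar> \<le> norm (f z) + norm (f y)"
        using R(3)[of "f z"] R(3)[of "f y"] by simp
      also have "\<dots> \<le> 2 * nrm (dual ?V) f"
        using V.dual_le_nrm[OF f, of z] V.dual_le_nrm[OF f, of y] z y(1) by simp
      finally show "(?\<delta> f)\<^sup>2 \<le> (2 * nrm (dual ?V) f)\<^sup>2"
        using power_mono[of "\<bar>?\<delta> f\<bar>" "2 * nrm (dual ?V) f" 2] by (simp only: power2_abs abs_ge_zero)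
    qed
    finally have "0 \<le> t\<^sup>2 + 2 * t * (\<Sum>f\<in>X. r y f * ?\<delta> f) + t\<^sup>2 * M"
      using y(2) t(1) by (simp add: mult_left_mono)
    then have "0 \<le> t * (t * (1 + M) + 2 * (\<Sum>f\<in>X. r y f * ?\<delta> f))"
      by (simp add: power2_eq_square algebra_simps)
    then have "0 \<le> t * (1 + M) + 2 * (\<Sum>f\<in>X. r y f * ?\<delta> f)"
      using t(1) unfolding zero_le_mult_iff by linarith
    then show ?thesis
      by linarith
  qed
  define g where "g z = (\<Sum>f\<in>X. of_real (- r y f) * f z)" for z
  have g: "g \<in> carr (dual ?V)" and Yg: "Y g = (\<Sum>f\<in>X. of_real (- r y f) * Y f)"
    unfolding g_def by (rule V.dual_sum(1)[OF X] V.dual_sum(2)[OF X Y(1)])+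
  have Rg: "R (g z) = (\<Sum>f\<in>X. - r y f * R (f z))" for z
    unfolding g_def R_sum by (simp only: R(2))
  have g_ball: "norm (g z) \<le> R (g y) + t * (1 + M) / 2" if z: "norm z < 1" for z
  proof -
    obtain c where c: "norm c = 1" "c * g z = of_real (norm (g z))"
      by (rule rotation)
    have "norm (g z) = R (of_real (norm (g z)))"
      using R(2)[of _ 1] R(4) by simp
    also have "\<dots> = R (g (s c z))"
      using dual_smul[OF g, of z c] c(2) by simp
    also have "\<dots> \<le> R (g y) + t * (1 + M) / 2"
      using var[of "s c z"] c(1) z
      by (simp add: Rg norm_scale right_diff_distrib sum_subtractf sum_negf)
    finally show ?thesis .
  qed
  have "nrm (dual ?V) g \<le> R (g y) + t * (1 + M) / 2"
  proof (rule V.dual_nrm_leI)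
    fix z
    assume z: "nrm ?V z \<le> 1"
    show "norm (g z) \<le> R (g y) + t * (1 + M) / 2"
    proof (rule field_le_mult_one_interval)
      fix a :: real
      assume a: "0 < a" "a < 1"
      have "a * norm z \<le> a * 1"
        using a z by (intro mult_left_mono) auto
      moreover have "norm (a *\<^sub>R z) = a * norm z"
        using a by simp
      ultimately have "norm (a *\<^sub>R z) < 1"
        using a by linarith
      then have "norm (g (a *\<^sub>R z)) \<le> R (g y) + t * (1 + M) / 2"
        by (rule g_ball)
      then show "a * norm (g z) \<le> R (g y) + t * (1 + M) / 2"
        using dual_smul[OF g, of z "of_real a"] a by (simp add: scale_of_real norm_mult)
    qed
  qed
  moreover have "R (Y g) \<le> nrm (dual ?V) g"
    using R(3)[of "Y g"] D.dual_memI_bound_one[OF Y g] by simp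
  moreover have "R (Y g) = (\<Sum>f\<in>X. - r y f * R (Y f))"
    unfolding Yg R_sum by (simp only: R(2))
  ultimately have "(\<Sum>f\<in>X. - r y f * R (Y f)) - (\<Sum>f\<in>X. - r y f * R (f y)) \<le> t * (1 + M) / 2"
    using Rg[of y] by simp
  also have "(\<Sum>f\<in>X. - r y f * R (Y f)) - (\<Sum>f\<in>X. - r y f * R (f y)) = N y"
    unfolding N_def sum_subtractf[symmetric]
    by (rule sum.cong) (simp_all add: r_def power2_eq_square algebra_simps)
  also have "t * (1 + M) / 2 < e\<^sup>2"
    using t(3) zero_less_power[OF e, of 2] by linarith
  finally have N: "N y < e\<^sup>2" .
  have "\<bar>R (f y) - R (Y f)\<bar> < e" if f: "f \<in> X" for f
  proof -
    have "(r y f)\<^sup>2 \<le> N y"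
      unfolding N_def using X(1) f by (intro member_le_sum) auto
    then have "\<bar>r y f\<bar>\<^sup>2 < e\<^sup>2"
      using N by simp
    then show ?thesis
      using power2_less_imp_less[of "\<bar>r y f\<bar>" e] e by (simp add: r_def)
  qed
  with y(1) show ?thesis
    by blast
qed

text \<open>
  Up to sign, the imaginary parts of functionals are the real parts of their multiples by \<open>j\<close>.
\<close>
lemma goldstine:
  fixes s :: "'k::real_or_complex \<Rightarrow> 'a::banach \<Rightarrow> 'a"
  assumes s: "banach_over s"
    and Y: "Y \<in> carr (dual (dual (of_type s)))" "nrm (dual (dual (of_type s))) Y \<le> 1"
    and X: "finite X" "X \<subseteq> carr (dual (of_type s))" and e: "0 < e"
  shows "\<exists>y. norm y < 1 \<and> (\<forall>f\<in>X. norm (f y - Y f) < e)"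
proof -
  interpret V: gauged_space "of_type s"
    by (rule gauged_of_type[OF s])
  interpret D: gauged_space "dual (of_type s)"
    by (rule V.gauged_dual)
  obtain R :: "'k \<Rightarrow> real" and j :: 'k where R: "\<And>a b. R (a + b) = R a + R b"
    "\<And>r a. R (of_real r * a) = r * R a" "\<And>a. \<bar>R a\<bar> \<le> norm a" "R 1 = 1"
    and eq: "\<And>a. a = of_real (R a) - j * of_real (R (j * a))" and j: "norm j \<le> 1"
    by (rule scalar_coordinates) blast
  have R_diff: "R (a - b) = R a - R b" for a b
    using R(1)[of "a - b" b] by simp
  let ?m = "\<lambda>f::'a \<Rightarrow> 'k. \<lambda>x. j * f x"
  have m: "?m f \<in> carr (dual (of_type s))" "Y (?m f) = j * Y f" if "f \<in> X" for f
    using D.smul_mem[of f j] dual_smul[OF Y(1), of f j] that X(2) by auto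
  have fin: "finite (X \<union> ?m ` X)" and sub: "X \<union> ?m ` X \<subseteq> carr (dual (of_type s))"
    using X m(1) by auto
  obtain y where y: "norm y < 1" "\<And>f. f \<in> X \<union> ?m ` X \<Longrightarrow> \<bar>R (f y) - R (Y f)\<bar> < e / 2"
    using goldstine_real_parts[OF s R Y fin sub, of "e / 2"] e by auto
  have "norm (f y - Y f) < e" if f: "f \<in> X" for f
  proof -
    let ?a = "f y - Y f"
    have "\<bar>R ?a\<bar> < e / 2" "\<bar>R (j * ?a)\<bar> < e / 2"
      using y(2)[of f] y(2)[of "?m f"] f m(2)[OF f] by (simp_all add: R_diff right_diff_distrib)
    moreover have "norm ?a \<le> \<bar>R ?a\<bar> + norm j * \<bar>R (j * ?a)\<bar>"
      by (subst eq) (use norm_triangle_ineq4[of "of_real (R ?a)" "j * of_real (R (j * ?a))"]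
          in \<open>simp add: norm_mult\<close>)
    moreover have "norm j * \<bar>R (j * ?a)\<bar> \<le> \<bar>R (j * ?a)\<bar>"
      using mult_right_mono[OF j, of "\<bar>R (j * ?a)\<bar>"] by simp
    ultimately show ?thesis
      by linarith
  qed
  with y(1) show ?thesis
    by blast
qed

text \<open>
  The conditions of Goldstine's theorem form a filter base on the ball of \<open>F\<close>, which is lifted to the
  ball of \<open>E\<close> because the quotient mapping is onto between the open balls.
\<close>
lemma goldstine_ultrafilter:
  fixes sE :: "'k::real_or_complex \<Rightarrow> 'e::banach \<Rightarrow> 'e" and sF :: "'k \<Rightarrow> 'f::banach \<Rightarrow> 'f"
  assumes sF: "banach_over sF" and \<rho>: "quotient_mapping sE sF \<rho>"
    and Y: "Y \<in> carr (dual (dual (of_type sF)))" "nrm (dual (dual (of_type sF))) Y \<le> 1"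
  obtains U where "ultrafilter U" "eventually (\<lambda>x. norm x \<le> 1) U"
    "\<And>f. f \<in> carr (dual (of_type sF)) \<Longrightarrow> ((\<lambda>x. f (\<rho> x)) \<longlongrightarrow> Y f) U"
proof -
  let ?I = "carr (dual (of_type sF)) \<times> {e::real. 0 < e}"
  let ?S = "\<lambda>(f, e). {x. norm x < 1 \<and> norm (f (\<rho> x) - Y f) < e}"
  let ?F = "INF i\<in>?I. principal (?S i)"
  have "?F \<noteq> bot"
  proof (rule INF_filter_not_bot)
    fix A
    assume A: "A \<subseteq> ?I" "finite A"
    \<comment> \<open>The smallest tolerance in \<open>A\<close>; inserting \<open>1\<close> provides for the empty family.\<close>
    define e where "e = Min (insert 1 (snd ` A))"
    have e: "0 < e" "\<And>i. i \<in> A \<Longrightarrow> e \<le> snd i"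
      using A by (auto simp: e_def)
    have "\<exists>y. norm y < 1 \<and> (\<forall>f\<in>fst ` A. norm (f y - Y f) < e)"
      by (rule goldstine[OF sF Y]) (use A e in auto)
    then obtain y where y: "norm y < 1" "\<And>i. i \<in> A \<Longrightarrow> norm (fst i y - Y (fst i)) < e"
      by auto
    then have "y \<in> \<rho> ` ball 0 1"
      using \<rho> by (simp add: quotient_mapping_def)
    then obtain x where x: "norm x < 1" "y = \<rho> x"
      by auto
    have "x \<in> (\<Inter>i\<in>A. ?S i)"
      using x y(2) e(2) by (force intro: less_le_trans)
    then show "(INF i\<in>A. principal (?S i)) \<noteq> bot"
      unfolding INF_principal_finite[OF A(2)] by (auto simp: principal_eq_bot_iff)
  qed
  then obtain U where U: "U \<le> ?F" "ultrafilter U"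
    by (rule ultrafilter_below)
  have ev: "eventually (\<lambda>x. norm x < 1 \<and> norm (f (\<rho> x) - Y f) < e) U"
    if "f \<in> carr (dual (of_type sF))" "0 < e" for f e
  proof -
    have "U \<le> principal (?S (f, e))"
      using U(1) INF_lower[of "(f, e)" ?I "\<lambda>i. principal (?S i)"] that by (auto intro: order_trans)
    then show ?thesis
      by (simp add: le_principal)
  qed
  interpret V: gauged_space "of_type sF"
    by (rule gauged_of_type[OF sF])
  interpret D: gauged_space "dual (of_type sF)"
    by (rule V.gauged_dual)
  show thesis
  proof
    show "eventually (\<lambda>x. norm x \<le> 1) U"
      using ev[OF D.zero_mem, of 1] by (auto elim: eventually_mono)
    show "((\<lambda>x. f (\<rho> x)) \<longlongrightarrow> Y f) U" if f: "f \<in> carr (dual (of_type sF))" for f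
    proof (rule tendstoI)
      fix e :: real
      assume "0 < e"
      then show "eventually (\<lambda>x. dist (f (\<rho> x)) (Y f) < e) U"
        using ev[OF f, of e] by (auto elim: eventually_mono simp: dist_norm)
    qed
  qed (rule U(2))
qed

section \<open>Weakly continuous functions of finite degree\<close>

text \<open>
  The degree is measured by iterated differences: taking a difference lowers the degree and keeps weak
  continuity on bounded sets, so that induction on the degree stays within one class of functions.
\<close>
fun degree_le :: "nat \<Rightarrow> ('a::ab_group_add \<Rightarrow> 'b::ab_group_add) \<Rightarrow> bool" where
  "degree_le 0 P \<longleftrightarrow> (\<forall>x y. P x = P y)"
| "degree_le (Suc n) P \<longleftrightarrow> (\<forall>b. degree_le n (\<lambda>x. P (x + b) - P x))"

lemma degree_le_const: "degree_le n (\<lambda>_. c)"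
  by (induction n arbitrary: c) auto

lemma degree_le_add: "degree_le n P \<Longrightarrow> degree_le n Q \<Longrightarrow> degree_le n (\<lambda>x. P x + Q x)"
proof (induction n arbitrary: P Q)
  case 0
  then show ?case
    by (auto intro: arg_cong2[of _ _ _ _ "(+)"])
next
  case (Suc n)
  show ?case
    unfolding degree_le.simps
  proof
    fix b
    have "degree_le n (\<lambda>x. (P (x + b) - P x) + (Q (x + b) - Q x))"
      using Suc.prems by (intro Suc.IH) auto
    then show "degree_le n (\<lambda>x. P (x + b) + Q (x + b) - (P x + Q x))"
      by (simp add: algebra_simps)
  qed
qed

lemma multilinear_add:
  assumes "multilinear_map n sE sF A" "i < n"
  shows "A (v(i := x + y)) = A (v(i := x)) + A (v(i := y))"
proof -
  have "Vector_Spaces.linear sE sF (\<lambda>x. A (v(i := x)))"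
    using assms by (simp add: multilinear_map_def)
  then show ?thesis
    unfolding Vector_Spaces.linear_iff by blast
qed

lemma multilinear_scale:
  assumes "multilinear_map n sE sF A" "i < n"
  shows "A (v(i := sE c x)) = sF c (A (v(i := x)))"
proof -
  have "Vector_Spaces.linear sE sF (\<lambda>x. A (v(i := x)))"
    using assms by (simp add: multilinear_map_def)
  then show ?thesis
    unfolding Vector_Spaces.linear_iff by blast
qed

text \<open>
  The slots in \<open>S\<close> hold the variable, up to the constants \<open>a\<close>. Replacing \<open>x\<close> by \<open>x + b\<close> in these slots
  one after the other changes the value at each step by a term with the constant \<open>b\<close> in the slot that
  is treated, so with one variable slot less. The constants have to be arbitrary because slots that
  are already treated hold \<open>x + b\<close>.
\<close>
lemma degree_le_multilinear:
  assumes A: "multilinear_map n sE sF A" and S: "S \<subseteq> {..<n}" "card S = k"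
  shows "degree_le k (\<lambda>x. A (\<lambda>i. (if i \<in> S then x else 0) + a i))"
  using S
proof (induction k arbitrary: S a)
  case 0
  then have "S = {}"
    by (meson card_eq_0_iff finite_lessThan finite_subset)
  then show ?case
    by simp
next
  case (Suc k)
  have fin: "finite S"
    using Suc.prems(1) finite_subset by blast
  show ?case
    unfolding degree_le.simps
  proof
    fix b
    let ?v = "\<lambda>T x i. (if i \<in> S then x else 0) + (a i + (if i \<in> T then b else 0))"
    have "degree_le k (\<lambda>x. A (?v T x) - A (?v {} x))" if "finite T" "T \<subseteq> S" for T
      using that
    proof (induction T rule: finite_induct)
      case empty
      then show ?case
        using degree_le_const[of k 0] by simp
    next
      case (insert j T)
      let ?c = "\<lambda>i. if i = j then b else a i + (if i \<in> T then b else 0)"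
      have j: "j < n" "j \<in> S"
        using insert.prems Suc.prems(1) by auto
      have upd: "A (w(j := w j + b)) = A w + A (w(j := b))" for w
        using multilinear_add[OF A j(1), of w "w j" b] by simp
      have "A (?v (insert j T) x) = A (?v T x) + A (\<lambda>i. (if i \<in> S - {j} then x else 0) + ?c i)" for x
      proof -
        have "?v (insert j T) x = (?v T x)(j := ?v T x j + b)"
          using insert.hyps(2) by (auto simp: fun_eq_iff add.assoc)
        moreover have "(\<lambda>i. (if i \<in> S - {j} then x else 0) + ?c i) = (?v T x)(j := b)"
          by (auto simp: fun_eq_iff)
        ultimately show ?thesis
          using upd[of "?v T x"] by simp
      qed
      then have "(\<lambda>x. A (?v (insert j T) x) - A (?v {} x)) =
          (\<lambda>x. (A (?v T x) - A (?v {} x)) + A (\<lambda>i. (if i \<in> S - {j} then x else 0) + ?c i))"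
        by (simp add: fun_eq_iff algebra_simps)
      moreover have "degree_le k (\<lambda>x. A (\<lambda>i. (if i \<in> S - {j} then x else 0) + ?c i))"
        using Suc.prems j(2) fin by (intro Suc.IH) auto
      ultimately show ?case
        using insert.IH insert.prems by (auto intro: degree_le_add)
    qed
    from this[OF fin order_refl]
    have "degree_le k (\<lambda>x. A (?v S x) - A (?v {} x))" .
    moreover have "?v S x = (\<lambda>i. (if i \<in> S then x + b else 0) + a i)" for x
      by (auto simp: fun_eq_iff algebra_simps)
    ultimately show "degree_le k (\<lambda>x. A (\<lambda>i. (if i \<in> S then x + b else 0) + a i) -
        A (\<lambda>i. (if i \<in> S then x else 0) + a i))"
      by (simp add: algebra_simps)
  qed
qed

lemma degree_le_homogeneous:
  assumes "homogeneous_polynomial n sE sF P"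
  shows "degree_le n P"
proof -
  obtain A where A: "multilinear_map n sE sF A" "\<And>x. P x = A (\<lambda>_. x)"
    using assms by (auto simp: homogeneous_polynomial_def)
  have "A (\<lambda>i. (if i \<in> {..<n} then x else 0) + 0) = P x" for x
  proof -
    have "\<forall>v w. (\<forall>i<n. v i = w i) \<longrightarrow> A v = A w"
      using A(1) by (simp add: multilinear_map_def)
    then show ?thesis
      unfolding A(2) by simp
  qed
  then show ?thesis
    using degree_le_multilinear[OF A(1), of "{..<n}" n "\<lambda>_. 0"] by simp
qed

lemma weakly_tendsto_translate:
  assumes "weakly_tendsto sE x \<F>"
  shows "weakly_tendsto sE (x + b) (filtermap (\<lambda>z. z + b) \<F>)"
  unfolding weakly_tendsto_def
proof
  fix \<phi>
  assume \<phi>: "\<phi> \<in> carr (dual (of_type sE))"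
  have "\<phi> (z + b) = \<phi> z + \<phi> b" for z
    using dual_add[OF \<phi>] by simp
  moreover have "((\<lambda>z. \<phi> z + \<phi> b) \<longlongrightarrow> \<phi> x + \<phi> b) \<F>"
    using assms \<phi> by (intro tendsto_add tendsto_const) (simp add: weakly_tendsto_def)
  ultimately show "(\<phi> \<longlongrightarrow> \<phi> (x + b)) (filtermap (\<lambda>z. z + b) \<F>)"
    by (simp add: filterlim_filtermap)
qed

lemma weakly_continuous_increment:
  assumes P: "weakly_continuous_on_bounded sE P"
  shows "weakly_continuous_on_bounded sE (\<lambda>x. P (x + b) - P x)"
  unfolding weakly_continuous_on_bounded_def
proof (intro allI impI tendsto_diff)
  fix \<F> B x
  assume B: "bounded B" "eventually (\<lambda>z. z \<in> B) \<F>" and x: "weakly_tendsto sE x \<F>"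
  show "(P \<longlongrightarrow> P x) \<F>"
    using P B x by (auto simp: weakly_continuous_on_bounded_def)
  have "bounded ((\<lambda>z. b + z) ` B)"
    by (rule bounded_translation[OF B(1)])
  moreover have "eventually (\<lambda>z. z \<in> (\<lambda>z. b + z) ` B) (filtermap (\<lambda>z. z + b) \<F>)"
    using B(2) by (auto simp: eventually_filtermap add.commute elim: eventually_mono)
  ultimately have "(P \<longlongrightarrow> P (x + b)) (filtermap (\<lambda>z. z + b) \<F>)"
    using P weakly_tendsto_translate[OF x] unfolding weakly_continuous_on_bounded_def by blast
  then show "((\<lambda>z. P (z + b)) \<longlongrightarrow> P (x + b)) \<F>"
    by (simp add: filterlim_filtermap)
qed

text \<open>
  Here \<open>U\<close> is weakly Cauchy but need not have a weak limit in \<open>E\<close>, so weak continuity at the limit is not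
  available. In its place, write \<open>P x\<close> as \<open>P (x - b)\<close> minus the increment \<open>P (x - b) - P x\<close>. Along
  \<open>U \<times>\<^sub>F U\<close> the difference \<open>x - b\<close> tends weakly to \<open>0\<close>, so that \<open>P (x - b)\<close> is close to \<open>P 0\<close> by weak
  continuity at \<open>0\<close>, for late \<open>x\<close> and one suitable fixed \<open>b\<close>. For this \<open>b\<close> the increment has lower degree
  and converges along \<open>U\<close> by induction. Hence \<open>P\<close> is Cauchy along \<open>U\<close>.
\<close>
lemma weakly_cauchy_convergence:
  fixes P :: "'e::banach \<Rightarrow> 'f::banach" and sE :: "'k::real_or_complex \<Rightarrow> 'e \<Rightarrow> 'e"
  assumes sE: "banach_over sE" and U: "U \<noteq> bot" "eventually (\<lambda>x. norm x \<le> 1) U"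
    and cauchy: "\<And>\<phi>. \<phi> \<in> carr (dual (of_type sE)) \<Longrightarrow> \<exists>l. (\<phi> \<longlongrightarrow> l) U"
    and "degree_le n P" "weakly_continuous_on_bounded sE P"
  shows "\<exists>y. (P \<longlongrightarrow> y) U"
  using assms(5,6)
proof (induction n arbitrary: P)
  case 0
  then have "P = (\<lambda>_. P 0)"
    by auto
  then show ?case
    by (metis tendsto_const)
next
  case (Suc n)
  interpret V: gauged_space "of_type sE"
    by (rule gauged_of_type[OF sE])
  let ?G = "filtermap (\<lambda>(x, b). x - b) (U \<times>\<^sub>F U)"
  have "weakly_tendsto sE 0 ?G"
    unfolding weakly_tendsto_def
  proof
    fix \<phi>
    assume \<phi>: "\<phi> \<in> carr (dual (of_type sE))"
    obtain l where l: "(\<phi> \<longlongrightarrow> l) U"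
      using cauchy[OF \<phi>] by blast
    have "\<phi> (x - b) = \<phi> x - \<phi> b" for x b
      using dual_add[OF \<phi>, of "x - b" b] by simp
    moreover have "((\<lambda>p. \<phi> (fst p) - \<phi> (snd p)) \<longlongrightarrow> l - l) (U \<times>\<^sub>F U)"
      by (intro tendsto_diff filterlim_compose[OF l] filterlim_fst filterlim_snd)
    ultimately show "(\<phi> \<longlongrightarrow> \<phi> 0) ?G"
      by (simp add: filterlim_filtermap case_prod_unfold V.dual_zero[OF \<phi>])
  qed
  moreover have "eventually (\<lambda>z. z \<in> cball 0 2) ?G"
  proof -
    have "eventually (\<lambda>p. norm (fst p) \<le> 1 \<and> norm (snd p) \<le> 1) (U \<times>\<^sub>F U)"
      using U(2) by (intro eventually_conj eventually_compose_filterlim[OF U(2)] filterlim_fst filterlim_snd)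
    then show ?thesis
      unfolding eventually_filtermap
    proof eventually_elim
      case (elim p)
      then show ?case
        using norm_triangle_ineq4[of "fst p" "snd p"] by (simp add: case_prod_unfold)
    qed
  qed
  ultimately have "(P \<longlongrightarrow> P 0) ?G"
    using Suc.prems(2) bounded_cball unfolding weakly_continuous_on_bounded_def by blast
  then have PG: "((\<lambda>p. P (fst p - snd p)) \<longlongrightarrow> P 0) (U \<times>\<^sub>F U)"
    by (simp add: filterlim_filtermap case_prod_unfold)
  have "cauchy_filter (filtermap P U)"
    unfolding cauchy_filter_metric_filtermap
  proof (intro allI impI)
    fix e :: real
    assume e: "0 < e"
    then have "eventually (\<lambda>p. dist (P (fst p - snd p)) (P 0) < e / 4) (U \<times>\<^sub>F U)"
      using tendstoD[OF PG, of "e / 4"] by simp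
    then obtain Q1 Q2 where Q: "eventually Q1 U" "eventually Q2 U"
      "\<And>x b. Q1 x \<Longrightarrow> Q2 b \<Longrightarrow> dist (P (x - b)) (P 0) < e / 4"
      unfolding eventually_prod_filter by auto
    obtain b where b: "Q2 b"
      using eventually_happens[OF Q(2)] U(1) by blast
    let ?D = "\<lambda>x. P (x + - b) - P x"
    obtain y where y: "(?D \<longlongrightarrow> y) U"
      using Suc.IH[OF _ weakly_continuous_increment[OF Suc.prems(2), of "- b"]] Suc.prems(1)
      unfolding degree_le.simps by blast
    let ?Q = "\<lambda>x. Q1 x \<and> dist (?D x) y < e / 4"
    have "eventually ?Q U"
      using Q(1) tendstoD[OF y, of "e / 4"] e by (simp add: eventually_conj)
    moreover have "dist (P x) (P x') < e" if x: "?Q x" and x': "?Q x'" for x x'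
    proof -
      have n: "norm (P (x - b) - P 0) < e / 4" "norm (P (x' - b) - P 0) < e / 4"
        "norm (?D x - y) < e / 4" "norm (?D x' - y) < e / 4"
        using Q(3)[OF _ b] x x' by (simp_all add: dist_norm)
      have "P x - P x' = ((P (x - b) - P 0) - (P (x' - b) - P 0)) - ((?D x - y) - (?D x' - y))"
        by simp
      then have "norm (P x - P x') \<le> (norm (P (x - b) - P 0) + norm (P (x' - b) - P 0)) +
          (norm (?D x - y) + norm (?D x' - y))"
        by (simp only: order_trans[OF norm_triangle_ineq4 add_mono[OF norm_triangle_ineq4 norm_triangle_ineq4]])
      then show ?thesis
        using n by (simp add: dist_norm)
    qed
    ultimately show "\<exists>Q. eventually Q U \<and> (\<forall>x y. Q x \<and> Q y \<longrightarrow> dist (P x) (P y) < e)"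
      by blast
  qed
  then have "\<exists>y. filtermap P U \<le> nhds y"
    using U(1) by (intro cauchy_filter_complete_converges[OF _ complete_UNIV]) (auto simp: filtermap_bot_iff)
  then show ?case
    by (simp add: filterlim_def)
qed

section \<open>The space of homogeneous polynomials\<close>

lemma bounded_linear_scale_right:
  assumes "banach_over s"
  shows "bounded_linear (s c)"
proof -
  interpret banach_over s
    by (rule assms)
  show ?thesis
  proof (rule bounded_linear_intro[of _ "norm c"])
    show "s c (r *\<^sub>R x) = r *\<^sub>R s c x" for r x
      using scale_left_commute[of c "of_real r" x] by (simp only: scale_of_real)
  qed (simp_all add: norm_scale mult.commute scale_right_distrib)
qed

lemma bounded_linear_scale_left:
  assumes "banach_over s"
  shows "bounded_linear (\<lambda>c. s c x)"
proof -
  interpret banach_over s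
    by (rule assms)
  show ?thesis
  proof (rule bounded_linear_intro[of _ "norm x"])
    show "s (r *\<^sub>R c) x = r *\<^sub>R s c x" for r c
      by (simp add: scaleR_conv_of_real scale_of_real flip: scale_scale)
  qed (simp_all add: norm_scale scale_left_distrib)
qed

lemma poly_space_simps [simp]:
  "P \<in> carr (poly_space n sE sF) \<longleftrightarrow> homogeneous_polynomial n sE sF P \<and> continuous_on UNIV P"
  "smul (poly_space n sE sF) c P = (\<lambda>x. sF c (P x))"
  by (simp_all add: poly_space_def)

lemma homogeneous_scale:
  assumes "banach_over sE" and sF: "banach_over sF" and P: "homogeneous_polynomial n sE sF P"
  shows "P (sE c x) = sF (c ^ n) (P x)"
proof -
  interpret F: banach_over sF
    by (rule sF)
  obtain A where A: "multilinear_map n sE sF A" "\<And>x. P x = A (\<lambda>_. x)"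
    using P by (auto simp: homogeneous_polynomial_def)
  have "A (\<lambda>i. if i < k then sE c x else x) = sF (c ^ k) (A (\<lambda>_. x))" if "k \<le> n" for k
    using that
  proof (induction k)
    case (Suc k)
    let ?v = "\<lambda>i. if i < k then sE c x else x"
    have "(\<lambda>i. if i < Suc k then sE c x else x) = ?v(k := sE c x)"
      by (auto simp: fun_eq_iff less_Suc_eq)
    moreover have "?v(k := x) = ?v"
      by (auto simp: fun_eq_iff)
    ultimately show ?case
      using multilinear_scale[OF A(1), of k ?v c x] Suc by simp
  qed simp
  then have "A (\<lambda>i. if i < n then sE c x else x) = sF (c ^ n) (A (\<lambda>_. x))"
    by blast
  moreover have "A (\<lambda>i. if i < n then sE c x else x) = A (\<lambda>_. sE c x)"
  proof -
    have "\<forall>v w. (\<forall>i<n. v i = w i) \<longrightarrow> A v = A w"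
      using A(1) by (simp add: multilinear_map_def)
    then show ?thesis
      by simp
  qed
  ultimately show ?thesis
    by (simp add: A(2))
qed

text \<open>
  Continuity at \<open>0\<close> bounds \<open>P\<close> on a small ball, and homogeneity carries the bound to the unit ball.
\<close>
lemma polynomial_bdd_above:
  assumes sE: "banach_over sE" and sF: "banach_over sF" and P: "P \<in> carr (poly_space n sE sF)"
  shows "bdd_above ((\<lambda>x. norm (P x)) ` cball 0 1)"
proof -
  interpret E: banach_over sE
    by (rule sE)
  interpret F: banach_over sF
    by (rule sF)
  have "continuous (at 0) P"
    using P by (simp add: continuous_on_eq_continuous_at)
  then obtain d where d: "0 < d" "\<And>x. norm x < d \<Longrightarrow> norm (P x - P 0) < 1"
    unfolding continuous_at_eps_delta by (metis diff_zero dist_norm zero_less_one)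
  show ?thesis
  proof (rule bdd_aboveI2)
    fix x :: 'b
    assume "x \<in> cball 0 1"
    then have x: "norm x \<le> 1"
      by simp
    let ?x = "(d / 2) *\<^sub>R x"
    have "norm ?x \<le> d / 2 * 1"
      using d(1) x by (simp only: norm_scaleR) (intro mult_mono, auto)
    then have "norm (P ?x) < norm (P 0) + 1"
      using d(2)[of ?x] d(1) norm_triangle_ineq2[of "P ?x" "P 0"] by linarith
    moreover have "P x = sF ((of_real (2 / d)) ^ n) (P ?x)"
      using homogeneous_scale[OF sE sF, of n P "of_real (2 / d)" ?x] P d(1)
      by (simp only: E.scale_of_real) simp
    ultimately show "norm (P x) \<le> (2 / d) ^ n * (norm (P 0) + 1)"
      using d(1) by (simp add: F.norm_scale norm_power norm_divide mult_left_mono)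
  qed
qed

lemma polynomial_le_nrm:
  assumes "banach_over sE" "banach_over sF" "P \<in> carr (poly_space n sE sF)" "norm x \<le> 1"
  shows "norm (P x) \<le> nrm (poly_space n sE sF) P"
proof -
  have "norm (P x) \<le> (SUP x\<in>cball 0 1. norm (P x))"
    using polynomial_bdd_above[OF assms(1-3)] assms(4) by (intro cSUP_upper) auto
  then show ?thesis
    by (simp add: poly_space_def)
qed

lemma polynomial_nrm_leI:
  fixes P :: "'e::banach \<Rightarrow> 'f::banach"
  assumes "\<And>x. norm x \<le> 1 \<Longrightarrow> norm (P x) \<le> B"
  shows "nrm (poly_space n sE sF) P \<le> B"
proof -
  have "(SUP x\<in>cball 0 1. norm (P x)) \<le> B"
    using assms by (intro cSUP_least) auto
  then show ?thesis
    by (simp add: poly_space_def)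
qed

lemma gauged_poly_space:
  fixes sE :: "'k::real_or_complex \<Rightarrow> 'e::banach \<Rightarrow> 'e" and sF :: "'k \<Rightarrow> 'f::banach \<Rightarrow> 'f"
  assumes sE: "banach_over sE" and sF: "banach_over sF"
  shows "gauged_space (poly_space n sE sF)"
proof -
  interpret E: banach_over sE
    by (rule sE)
  interpret F: banach_over sF
    by (rule sF)
  note lin = Vector_Spaces.linear_iff
  show ?thesis
  proof
    have "multilinear_map n sE sF (\<lambda>_. 0)"
      by (simp add: multilinear_map_def lin E.vector_space_axioms F.vector_space_axioms)
    then show "0 \<in> carr (poly_space n sE sF)"
      by (auto simp: homogeneous_polynomial_def zero_fun_def)
    fix P Q :: "'e \<Rightarrow> 'f" and c :: 'k
    assume P: "P \<in> carr (poly_space n sE sF)"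
    then obtain A where A: "multilinear_map n sE sF A" "P = (\<lambda>x. A (\<lambda>_. x))"
      by (auto simp: homogeneous_polynomial_def)
    show "P + Q \<in> carr (poly_space n sE sF)" if Q: "Q \<in> carr (poly_space n sE sF)"
    proof -
      obtain B where B: "multilinear_map n sE sF B" "Q = (\<lambda>x. B (\<lambda>_. x))"
        using Q by (auto simp: homogeneous_polynomial_def)
      have "multilinear_map n sE sF (\<lambda>v. A v + B v)"
        using A(1) B(1) by (auto simp: multilinear_map_def lin F.scale_right_distrib intro: arg_cong2[of _ _ _ _ "(+)"])
      moreover have "continuous_on UNIV (\<lambda>x. P x + Q x)"
        using P Q by (intro continuous_on_add) auto
      ultimately show ?thesis
        by (auto simp: homogeneous_polynomial_def plus_fun_def A(2) B(2))
    qed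
    have "multilinear_map n sE sF (\<lambda>v. sF c (A v))"
      using A(1) by (auto simp: multilinear_map_def lin F.scale_right_distrib mult.commute
          intro: arg_cong[of _ _ "sF c"])
    moreover have "continuous_on UNIV (\<lambda>x. sF c (P x))"
      using P by (intro bounded_linear.continuous_on[OF bounded_linear_scale_right[OF sF]]) auto
    ultimately show "smul (poly_space n sE sF) c P \<in> carr (poly_space n sE sF)"
      by (auto simp: homogeneous_polynomial_def A(2))
    show "0 \<le> nrm (poly_space n sE sF) P"
      using polynomial_le_nrm[OF sE sF P, of 0] order_trans[OF norm_ge_zero] by simp
    show "nrm (poly_space n sE sF) (smul (poly_space n sE sF) c P) = norm c * nrm (poly_space n sE sF) P"
      using cSUP_mult_left[OF _ polynomial_bdd_above[OF sE sF P], of "norm c"]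
      by (simp add: poly_space_def F.norm_scale)
  qed
qed

text \<open>
  This covers both families of test polynomials: \<open>L\<close> is the quotient mapping in the one and
  \<open>x \<mapsto> g x \<cdot> y\<close> in the other.
\<close>
lemma functional_times_operator:
  fixes sE :: "'k::real_or_complex \<Rightarrow> 'e::banach \<Rightarrow> 'e" and sF :: "'k \<Rightarrow> 'f::banach \<Rightarrow> 'f"
  assumes sE: "banach_over sE" and sF: "banach_over sF" and g: "g \<in> carr (dual (of_type sE))"
    and L: "Vector_Spaces.linear sE sF L" "bounded_linear L"
  shows "(\<lambda>x. sF (g x ^ m) (L x)) \<in> carr (poly_space (Suc m) sE sF)"
proof -
  interpret E: banach_over sE
    by (rule sE)
  interpret F: banach_over sF
    by (rule sF)
  interpret V: gauged_space "of_type sE"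
    by (rule gauged_of_type[OF sE])
  let ?A = "\<lambda>v. sF (\<Prod>i<m. g (v i)) (L (v m))"
  have g_lin: "g (x + y) = g x + g y" "g (sE c x) = c * g x" for x y c
    using dual_add[OF g, of x y] dual_smul[OF g, of x c] by simp_all
  have L_lin: "L (x + y) = L x + L y" "L (sE c x) = sF c (L x)" for x y c
    using L(1) by (simp_all add: Vector_Spaces.linear_iff)
  have "Vector_Spaces.linear sE sF (\<lambda>x. ?A (v(i := x)))" if i: "i < Suc m" for v i
  proof (cases "i = m")
    case True
    then have "?A (v(i := x)) = sF (\<Prod>i<m. g (v i)) (L x)" for x
      by simp
    then show ?thesis
      by (simp add: Vector_Spaces.linear_iff E.vector_space_axioms F.vector_space_axioms L_lin
          F.scale_right_distrib mult.commute)
  next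
    case False
    have "(\<Prod>k<m. g ((v(i := x)) k)) = g x * (\<Prod>k\<in>{..<m} - {i}. g (v k))" for x
    proof -
      have "(\<Prod>k<m. g ((v(i := x)) k)) = g x * (\<Prod>k\<in>{..<m} - {i}. g ((v(i := x)) k))"
        using i False by (subst prod.remove[of _ i]) auto
      also have "(\<Prod>k\<in>{..<m} - {i}. g ((v(i := x)) k)) = (\<Prod>k\<in>{..<m} - {i}. g (v k))"
        by (rule prod.cong) auto
      finally show ?thesis .
    qed
    then have "?A (v(i := x)) = sF (g x * (\<Prod>k\<in>{..<m} - {i}. g (v k))) (L (v m))" for x
      using False by simp
    then show ?thesis
      by (simp add: Vector_Spaces.linear_iff E.vector_space_axioms F.vector_space_axioms g_lin
          F.scale_left_distrib distrib_right mult.assoc)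
  qed
  moreover have "?A v = ?A w" if "\<forall>i<Suc m. v i = w i" for v w
    using that by simp
  ultimately have "multilinear_map (Suc m) sE sF ?A"
    by (auto simp: multilinear_map_def)
  then have "homogeneous_polynomial (Suc m) sE sF (\<lambda>x. sF (g x ^ m) (L x))"
    unfolding homogeneous_polynomial_def by (intro exI[of _ ?A]) simp
  moreover have "continuous_on UNIV (\<lambda>x. sF (g x ^ m) (L x))"
  proof -
    have "continuous_on UNIV g"
    proof (rule linear_continuous_on, rule bounded_linear_intro[of _ "nrm (dual (of_type sE)) g"])
      show "g (r *\<^sub>R x) = r *\<^sub>R g x" for r x
        using g_lin(2)[of "of_real r" x] by (simp add: E.scale_of_real scaleR_conv_of_real)
      show "norm (g x) \<le> norm x * nrm (dual (of_type sE)) g" for x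
        using V.dual_bound[OF g, of x] by (simp add: mult.commute)
    qed (rule g_lin)
    then have "continuous_on UNIV (\<lambda>x. g x ^ m)"
      by (rule continuous_on_power)
    moreover have "bounded_bilinear sF"
    proof
      show "sF (r *\<^sub>R a) b = r *\<^sub>R sF a b" for r a b
        by (simp add: scaleR_conv_of_real F.scale_of_real flip: F.scale_scale)
      show "sF a (r *\<^sub>R b) = r *\<^sub>R sF a b" for r a b
        using F.scale_left_commute[of a "of_real r" b] by (simp only: F.scale_of_real)
      show "\<exists>K. \<forall>a b. norm (sF a b) \<le> norm a * norm b * K"
        by (rule exI[of _ 1]) (simp add: F.norm_scale)
    qed (simp_all add: F.scale_left_distrib F.scale_right_distrib)
    ultimately show ?thesis
      using linear_continuous_on[OF L(2)] by (metis bounded_bilinear.continuous_on)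
  qed
  ultimately show ?thesis
    by simp
qed

lemma finite_rank_power:
  fixes sE :: "'k::real_or_complex \<Rightarrow> 'e::banach \<Rightarrow> 'e" and sF :: "'k \<Rightarrow> 'f::banach \<Rightarrow> 'f"
  assumes sE: "banach_over sE" and sF: "banach_over sF" and g: "g \<in> carr (dual (of_type sE))"
  shows "(\<lambda>x. sF (g x ^ Suc m) y) \<in> wcont_polys (Suc m) sE sF"
proof -
  interpret E: banach_over sE
    by (rule sE)
  interpret F: banach_over sF
    by (rule sF)
  interpret V: gauged_space "of_type sE"
    by (rule gauged_of_type[OF sE])
  have g_lin: "g (a + b) = g a + g b" "g (sE c a) = c * g a" for a b c
    using dual_add[OF g, of a b] dual_smul[OF g, of a c] by simp_all
  let ?L = "\<lambda>x. sF (g x) y"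
  have "Vector_Spaces.linear sE sF ?L"
    by (simp add: Vector_Spaces.linear_iff E.vector_space_axioms F.vector_space_axioms g_lin
        F.scale_left_distrib)
  moreover have "bounded_linear ?L"
  proof (rule bounded_linear_intro[of _ "nrm (dual (of_type sE)) g * norm y"])
    show "?L (r *\<^sub>R x) = r *\<^sub>R ?L x" for r x
      using g_lin(2)[of "of_real r" x] by (simp add: E.scale_of_real F.scale_of_real flip: F.scale_scale)
    show "norm (?L x) \<le> norm x * (nrm (dual (of_type sE)) g * norm y)" for x
      using mult_right_mono[OF V.dual_bound[OF g, of x], of "norm y"]
      by (simp add: F.norm_scale mult.commute mult.left_commute)
  qed (simp add: g_lin F.scale_left_distrib)
  ultimately have "(\<lambda>x. sF (g x ^ m) (?L x)) \<in> carr (poly_space (Suc m) sE sF)"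
    by (rule functional_times_operator[OF sE sF g])
  then have "(\<lambda>x. sF (g x ^ Suc m) y) \<in> carr (poly_space (Suc m) sE sF)"
    by (simp add: mult.commute)
  moreover have "weakly_continuous_on_bounded sE (\<lambda>x. sF (g x ^ Suc m) y)"
    unfolding weakly_continuous_on_bounded_def
  proof (intro allI impI)
    fix \<F> x
    assume "weakly_tendsto sE x \<F>"
    then have "(g \<longlongrightarrow> g x) \<F>"
      using g by (simp add: weakly_tendsto_def)
    then show "((\<lambda>x. sF (g x ^ Suc m) y) \<longlongrightarrow> sF (g x ^ Suc m) y) \<F>"
      by (intro bounded_linear.tendsto[OF bounded_linear_scale_left[OF sF]] tendsto_power)
  qed
  ultimately show ?thesis
    by (simp add: wcont_polys_def)
qed

section \<open>Limits of polynomials in the bidual\<close>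

locale bounded_ultrafilter =
  fixes sE :: "'k::real_or_complex \<Rightarrow> 'e::banach \<Rightarrow> 'e" and sF :: "'k \<Rightarrow> 'f::banach \<Rightarrow> 'f"
    and n :: nat and U :: "'e filter"
  assumes sE: "banach_over sE" and sF: "banach_over sF"
    and ultra: "ultrafilter U" and unit_ball: "eventually (\<lambda>x. norm x \<le> 1) U"
begin

sublocale F: gauged_space "of_type sF"
  by (rule gauged_of_type[OF sF])
sublocale D: gauged_space "dual (of_type sF)"
  by (rule F.gauged_dual)
sublocale B: gauged_space "dual (dual (of_type sF))"
  by (rule D.gauged_dual)
sublocale P: gauged_space "poly_space n sE sF"
  by (rule gauged_poly_space[OF sE sF])

text \<open>
  The weak* limit of \<open>P\<close> along the ultrafilter. The value \<open>0\<close> off the dual space is the normalisation of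
  functionals outside their carrier.
\<close>
definition bidual_limit :: "('e \<Rightarrow> 'f) \<Rightarrow> ('f \<Rightarrow> 'k) \<Rightarrow> 'k" where
  "bidual_limit P = (\<lambda>f. if f \<in> carr (dual (of_type sF)) then Lim U (\<lambda>x. f (P x)) else 0)"

lemma nonbot: "U \<noteq> bot"
  using ultra by (simp add: ultrafilter_def)

lemma polynomial_dual_bound:
  assumes "P \<in> carr (poly_space n sE sF)" "f \<in> carr (dual (of_type sF))" "norm x \<le> 1"
  shows "norm (f (P x)) \<le> nrm (poly_space n sE sF) P * nrm (dual (of_type sF)) f"
proof -
  have "norm (f (P x)) \<le> nrm (dual (of_type sF)) f * norm (P x)"
    using F.dual_bound[OF assms(2), of "P x"] by simp
  also have "\<dots> \<le> nrm (dual (of_type sF)) f * nrm (poly_space n sE sF) P"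
    using polynomial_le_nrm[OF sE sF assms(1,3)] D.nrm_nonneg[OF assms(2)]
    by (intro mult_left_mono)
  finally show ?thesis
    by (simp add: mult.commute)
qed

lemma bidual_limit_tendsto:
  assumes P: "P \<in> carr (poly_space n sE sF)" and f: "f \<in> carr (dual (of_type sF))"
  shows "((\<lambda>x. f (P x)) \<longlongrightarrow> bidual_limit P f) U"
proof -
  let ?K = "cball (0::'k) (nrm (poly_space n sE sF) P * nrm (dual (of_type sF)) f)"
  have "eventually (\<lambda>x. f (P x) \<in> ?K) U"
    using unit_ball by eventually_elim (use polynomial_dual_bound[OF P f] in simp)
  then obtain l where "((\<lambda>x. f (P x)) \<longlongrightarrow> l) U"
    using ultrafilter_compact_limit[OF ultra compact_cball_scalar, of "\<lambda>x. f (P x)"] by blast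
  then show ?thesis
    using f tendsto_Lim[OF nonbot, of "\<lambda>x. f (P x)" l] by (simp add: bidual_limit_def)
qed

lemma bidual_limit_eqI:
  assumes P: "P \<in> carr (poly_space n sE sF)" and f: "f \<in> carr (dual (of_type sF))"
    and "((\<lambda>x. f (P x)) \<longlongrightarrow> l) U"
  shows "bidual_limit P f = l"
  using tendsto_unique[OF nonbot bidual_limit_tendsto[OF P f] assms(3)] .

lemma bidual_limit_bound:
  assumes P: "P \<in> carr (poly_space n sE sF)" and f: "f \<in> carr (dual (of_type sF))"
  shows "norm (bidual_limit P f) \<le> nrm (poly_space n sE sF) P * nrm (dual (of_type sF)) f"
  using unit_ball
  by (intro tendsto_upperbound[OF tendsto_norm[OF bidual_limit_tendsto[OF P f]] _ nonbot])
    (auto elim: eventually_mono intro: polynomial_dual_bound[OF P f])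

lemma bidual_limit_mem:
  assumes P: "P \<in> carr (poly_space n sE sF)"
  shows "bidual_limit P \<in> carr (dual (dual (of_type sF)))"
proof (rule dual_memI)
  fix f g and c :: 'k
  assume f: "f \<in> carr (dual (of_type sF))"
  show "bidual_limit P (f + g) = bidual_limit P f + bidual_limit P g"
    if g: "g \<in> carr (dual (of_type sF))"
    using tendsto_add[OF bidual_limit_tendsto[OF P f] bidual_limit_tendsto[OF P g]]
    by (intro bidual_limit_eqI[OF P D.add_mem[OF f g]]) simp
  show "bidual_limit P (smul (dual (of_type sF)) c f) = c * bidual_limit P f"
    using tendsto_mult_left[OF bidual_limit_tendsto[OF P f], of c]
    by (intro bidual_limit_eqI[OF P D.smul_mem[OF f]]) simp
  show "norm (bidual_limit P f) \<le> nrm (poly_space n sE sF) P * nrm (dual (of_type sF)) f"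
    by (rule bidual_limit_bound[OF P f])
qed (simp add: bidual_limit_def)

lemma bidual_limit_nrm:
  assumes P: "P \<in> carr (poly_space n sE sF)"
  shows "nrm (dual (dual (of_type sF))) (bidual_limit P) \<le> nrm (poly_space n sE sF) P"
proof (rule D.dual_nrm_leI)
  fix f
  assume f: "f \<in> carr (dual (of_type sF))" "nrm (dual (of_type sF)) f \<le> 1"
  show "norm (bidual_limit P f) \<le> nrm (poly_space n sE sF) P"
    using bidual_limit_bound[OF P f(1)] mult_left_mono[OF f(2) P.nrm_nonneg[OF P]] by simp
qed

lemma bidual_limit_add:
  assumes P: "P \<in> carr (poly_space n sE sF)" and Q: "Q \<in> carr (poly_space n sE sF)"
  shows "bidual_limit (P + Q) = bidual_limit P + bidual_limit Q"
proof
  fix f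
  show "bidual_limit (P + Q) f = (bidual_limit P + bidual_limit Q) f"
  proof (cases "f \<in> carr (dual (of_type sF))")
    case True
    have "f (P x + Q x) = f (P x) + f (Q x)" for x
      using dual_add[OF True] by simp
    then show ?thesis
      using tendsto_add[OF bidual_limit_tendsto[OF P True] bidual_limit_tendsto[OF Q True]]
      by (intro bidual_limit_eqI[OF P.add_mem[OF P Q] True]) simp
  qed (simp add: bidual_limit_def)
qed

lemma bidual_limit_smul:
  assumes P: "P \<in> carr (poly_space n sE sF)"
  shows "bidual_limit (smul (poly_space n sE sF) c P) = smul (dual (dual (of_type sF))) c (bidual_limit P)"
proof
  fix f
  show "bidual_limit (smul (poly_space n sE sF) c P) f = smul (dual (dual (of_type sF))) c (bidual_limit P) f"
  proof (cases "f \<in> carr (dual (of_type sF))")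
    case True
    have "f (sF c (P x)) = c * f (P x)" for x
      using dual_smul[OF True, of "P x" c] by simp
    then have "((\<lambda>x. f (smul (poly_space n sE sF) c P x)) \<longlongrightarrow> c * bidual_limit P f) U"
      using tendsto_mult_left[OF bidual_limit_tendsto[OF P True], of c] by simp
    then show ?thesis
      using bidual_limit_eqI[OF P.smul_mem[OF P] True] by simp
  qed (simp add: bidual_limit_def)
qed

text \<open>
  By compactness of bounded sets of scalars, \<open>U\<close> is weakly Cauchy; so weakly continuous polynomials
  converge in norm and their limit stays in \<open>F\<close>.
\<close>
lemma bidual_limit_wcont:
  assumes P: "P \<in> wcont_polys n sE sF"
  obtains y where "bidual_limit P = canonical_embedding (of_type sF) y"
proof -
  have mem: "P \<in> carr (poly_space n sE sF)" and wc: "weakly_continuous_on_bounded sE P"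
    using P by (simp_all add: wcont_polys_def)
  interpret E: gauged_space "of_type sE"
    by (rule gauged_of_type[OF sE])
  have "\<exists>l. (\<phi> \<longlongrightarrow> l) U" if \<phi>: "\<phi> \<in> carr (dual (of_type sE))" for \<phi>
  proof -
    have "eventually (\<lambda>x. \<phi> x \<in> cball 0 (nrm (dual (of_type sE)) \<phi>)) U"
      using unit_ball by eventually_elim (use E.dual_le_nrm[OF \<phi>] in simp)
    then show ?thesis
      using ultrafilter_compact_limit[OF ultra compact_cball_scalar, of \<phi>] by blast
  qed
  moreover have "degree_le n P"
    using mem degree_le_homogeneous[of n sE sF P] by simp
  ultimately obtain y where y: "(P \<longlongrightarrow> y) U"
    using weakly_cauchy_convergence[OF sE nonbot unit_ball _ _ wc] by blast
  have "bidual_limit P f = canonical_embedding (of_type sF) y f" for f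
  proof (cases "f \<in> carr (dual (of_type sF))")
    case True
    have "((\<lambda>x. f (P x - y)) \<longlongrightarrow> 0) U"
    proof (rule Lim_null_comparison)
      show "eventually (\<lambda>x. norm (f (P x - y)) \<le> nrm (dual (of_type sF)) f * norm (P x - y)) U"
        using F.dual_bound[OF True] by simp
      show "((\<lambda>x. nrm (dual (of_type sF)) f * norm (P x - y)) \<longlongrightarrow> 0) U"
        using y by (intro tendsto_mult_right_zero tendsto_norm_zero) (simp add: LIM_zero)
    qed
    moreover have "f (P x) = f (P x - y) + f y" for x
      using dual_add[OF True, of "P x - y" y] by simp
    ultimately have "((\<lambda>x. f (P x)) \<longlongrightarrow> f y) U"
      using tendsto_add[OF _ tendsto_const, of "\<lambda>x. f (P x - y)" 0 U "f y"] by simp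
    then show ?thesis
      using bidual_limit_eqI[OF mem True] True by (simp add: canonical_embedding_apply)
  qed (simp add: bidual_limit_def canonical_embedding_def)
  then show thesis
    using that by blast
qed

definition lift :: "((('f \<Rightarrow> 'k) \<Rightarrow> 'k) \<Rightarrow> 'k) \<Rightarrow> ('e \<Rightarrow> 'f) \<Rightarrow> 'k" where
  "lift \<phi> = (\<lambda>P. if P \<in> carr (poly_space n sE sF) then \<phi> (bidual_limit P) else 0)"

lemma lift_apply: "P \<in> carr (poly_space n sE sF) \<Longrightarrow> lift \<phi> P = \<phi> (bidual_limit P)"
  by (simp only: lift_def if_True)

lemma
  assumes \<phi>: "\<phi> \<in> carr (dual (dual (dual (of_type sF))))"
  shows lift_mem: "lift \<phi> \<in> carr (dual (poly_space n sE sF))"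
    and lift_nrm: "nrm (dual (poly_space n sE sF)) (lift \<phi>) \<le> nrm (dual (dual (dual (of_type sF)))) \<phi>"
proof -
  have bound: "norm (lift \<phi> P) \<le> nrm (dual (dual (dual (of_type sF)))) \<phi> * nrm (poly_space n sE sF) P"
    if P: "P \<in> carr (poly_space n sE sF)" for P
  proof -
    have "norm (lift \<phi> P) \<le> nrm (dual (dual (dual (of_type sF)))) \<phi> * nrm (dual (dual (of_type sF))) (bidual_limit P)"
      unfolding lift_apply[OF P] by (rule B.dual_bound[OF \<phi> bidual_limit_mem[OF P]])
    also have "\<dots> \<le> nrm (dual (dual (dual (of_type sF)))) \<phi> * nrm (poly_space n sE sF) P"
      by (rule mult_left_mono[OF bidual_limit_nrm[OF P] B.dual_nrm_nonneg[OF \<phi>]])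
    finally show ?thesis .
  qed
  show "lift \<phi> \<in> carr (dual (poly_space n sE sF))"
  proof (rule dual_memI[OF _ _ bound])
    show "lift \<phi> (P + Q) = lift \<phi> P + lift \<phi> Q"
      if "P \<in> carr (poly_space n sE sF)" "Q \<in> carr (poly_space n sE sF)" for P Q
      using that P.add_mem[OF that]
      by (simp only: lift_apply bidual_limit_add dual_add[OF \<phi>] bidual_limit_mem)
    show "lift \<phi> (smul (poly_space n sE sF) c P) = c * lift \<phi> P"
      if "P \<in> carr (poly_space n sE sF)" for c P
      using that P.smul_mem[OF that]
      by (simp only: lift_apply bidual_limit_smul dual_smul[OF \<phi>] bidual_limit_mem)
    show "lift \<phi> P = 0" if "P \<notin> carr (poly_space n sE sF)" for P
      using that by (simp only: lift_def if_False)
  qed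
  show "nrm (dual (poly_space n sE sF)) (lift \<phi>) \<le> nrm (dual (dual (dual (of_type sF)))) \<phi>"
  proof (rule P.dual_nrm_leI)
    fix P
    assume P: "P \<in> carr (poly_space n sE sF)" "nrm (poly_space n sE sF) P \<le> 1"
    show "norm (lift \<phi> P) \<le> nrm (dual (dual (dual (of_type sF)))) \<phi>"
      using bound[OF P(1)] mult_left_mono[OF P(2) B.dual_nrm_nonneg[OF \<phi>]] by simp
  qed
qed

end

section \<open>The canonical projection of the third dual\<close>

definition canonical_projection ::
    "('k::real_or_complex \<Rightarrow> 'f::banach \<Rightarrow> 'f) \<Rightarrow> ((('f \<Rightarrow> 'k) \<Rightarrow> 'k) \<Rightarrow> 'k) \<Rightarrow> (('f \<Rightarrow> 'k) \<Rightarrow> 'k) \<Rightarrow> 'k" where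
  "canonical_projection s \<phi> =
     canonical_embedding (dual (of_type s)) (\<lambda>y. \<phi> (canonical_embedding (of_type s) y))"

context
  fixes s :: "'k::real_or_complex \<Rightarrow> 'f::banach \<Rightarrow> 'f"
  assumes s: "banach_over s"
begin

interpretation F: gauged_space "of_type s"
  by (rule gauged_of_type[OF s])
interpretation D: gauged_space "dual (of_type s)"
  by (rule F.gauged_dual)
interpretation B: gauged_space "dual (dual (of_type s))"
  by (rule D.gauged_dual)

lemma canonical_embedding_bidual: "canonical_embedding (of_type s) y \<in> carr (dual (dual (of_type s)))"
  by (rule F.canonical_embedding_mem) simp

lemma nrm_canonical_embedding_bidual:
  "nrm (dual (dual (of_type s))) (canonical_embedding (of_type s) y) \<le> norm y"
  using F.nrm_canonical_embedding_le[of y] by simp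

lemma restriction_mem:
  assumes \<phi>: "\<phi> \<in> carr (dual (dual (dual (of_type s))))"
  shows "(\<lambda>y. \<phi> (canonical_embedding (of_type s) y)) \<in> carr (dual (of_type s))"
proof -
  let ?J = "canonical_embedding (of_type s)" and ?B = "dual (dual (of_type s))"
  have lin: "linear_between (of_type s) ?B ?J"
    by (rule canonical_embedding_linear[OF F.gauged_space_axioms])
  have J: "?J (x + y) = ?J x + ?J y" "?J (s c x) = smul ?B c (?J x)" for x y c
    using lin by (simp_all add: linear_between_def)
  have bound: "norm (\<phi> (?J y)) \<le> nrm (dual ?B) \<phi> * norm y" for y
    using B.dual_bound[OF \<phi> canonical_embedding_bidual]
      mult_left_mono[OF nrm_canonical_embedding_bidual B.dual_nrm_nonneg[OF \<phi>]]
    by (rule order_trans)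
  show "(\<lambda>y. \<phi> (?J y)) \<in> carr (dual (of_type s))"
  proof (rule dual_memI)
    show "\<phi> (?J (x + y)) = \<phi> (?J x) + \<phi> (?J y)" for x y
      by (simp only: J dual_add[OF \<phi> canonical_embedding_bidual canonical_embedding_bidual])
    show "\<phi> (?J (smul (of_type s) c x)) = c * \<phi> (?J x)" for c x
      by (simp only: J of_type_simps dual_smul[OF \<phi> canonical_embedding_bidual])
    show "norm (\<phi> (?J y)) \<le> nrm (dual ?B) \<phi> * nrm (of_type s) y" for y
      using bound by simp
  qed simp
qed

lemma canonical_projection_mem:
  "\<phi> \<in> carr (dual (dual (dual (of_type s)))) \<Longrightarrow>
     canonical_projection s \<phi> \<in> carr (dual (dual (dual (of_type s))))"
  unfolding canonical_projection_def by (intro D.canonical_embedding_mem restriction_mem)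

lemma canonical_projection_nrm:
  "\<phi> \<in> carr (dual (dual (dual (of_type s)))) \<Longrightarrow>
     nrm (dual (dual (dual (of_type s)))) (canonical_projection s \<phi>) \<le>
     nrm (dual (of_type s)) (\<lambda>y. \<phi> (canonical_embedding (of_type s) y))"
  unfolding canonical_projection_def by (intro D.nrm_canonical_embedding_le restriction_mem)

lemma canonical_projection_apply:
  "Y \<in> carr (dual (dual (of_type s))) \<Longrightarrow>
     canonical_projection s \<phi> Y = Y (\<lambda>y. \<phi> (canonical_embedding (of_type s) y))"
  by (simp add: canonical_projection_def canonical_embedding_apply)

lemma canonical_projection_embedded:
  assumes "\<phi> \<in> carr (dual (dual (dual (of_type s))))"
  shows "canonical_projection s \<phi> (canonical_embedding (of_type s) y) =
    \<phi> (canonical_embedding (of_type s) y)"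
  using restriction_mem[OF assms] canonical_embedding_bidual
  by (simp add: canonical_projection_apply canonical_embedding_apply)

lemma canonical_projection_linear:
  "linear_between (dual (dual (dual (of_type s)))) (dual (dual (dual (of_type s))))
     (canonical_projection s)"
proof -
  have "canonical_projection s (\<phi> + \<psi>) = canonical_projection s \<phi> + canonical_projection s \<psi>"
    and "canonical_projection s (smul (dual (dual (dual (of_type s)))) c \<phi>) =
      smul (dual (dual (dual (of_type s)))) c (canonical_projection s \<phi>)"
    if \<phi>: "\<phi> \<in> carr (dual (dual (dual (of_type s))))"
      and \<psi>: "\<psi> \<in> carr (dual (dual (dual (of_type s))))" for \<phi> \<psi> c
  proof -
    let ?r = "\<lambda>\<phi> y. \<phi> (canonical_embedding (of_type s) y)"
    have "?r (\<phi> + \<psi>) = ?r \<phi> + ?r \<psi>"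
      "?r (smul (dual (dual (dual (of_type s)))) c \<phi>) = smul (dual (of_type s)) c (?r \<phi>)"
      by (simp_all add: fun_eq_iff)
    then show "canonical_projection s (\<phi> + \<psi>) = canonical_projection s \<phi> + canonical_projection s \<psi>"
      and "canonical_projection s (smul (dual (dual (dual (of_type s)))) c \<phi>) =
        smul (dual (dual (dual (of_type s)))) c (canonical_projection s \<phi>)"
      using canonical_embedding_linear[OF D.gauged_space_axioms] restriction_mem[OF \<phi>]
        restriction_mem[OF \<psi>]
      unfolding canonical_projection_def linear_between_def by metis+
  qed
  then show ?thesis
    unfolding linear_between_def using canonical_projection_mem by blast
qed

lemma canonical_projection_idempotent:
  "\<phi> \<in> carr (dual (dual (dual (of_type s)))) \<Longrightarrow>
     canonical_projection s (canonical_projection s \<phi>) = canonical_projection s \<phi>"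
  unfolding canonical_projection_def[of s "canonical_projection s \<phi>"]
  by (simp add: canonical_projection_embedded) (simp add: canonical_projection_def)

lemma canonical_projection_kernel:
  "{\<phi> \<in> carr (dual (dual (dual (of_type s)))). canonical_projection s \<phi> = 0} =
     annihilator (dual (dual (of_type s))) (range (canonical_embedding (of_type s)))"
proof -
  have "canonical_projection s \<phi> = 0 \<longleftrightarrow> (\<forall>y. \<phi> (canonical_embedding (of_type s) y) = 0)"
    if \<phi>: "\<phi> \<in> carr (dual (dual (dual (of_type s))))" for \<phi>
  proof
    assume "canonical_projection s \<phi> = 0"
    then show "\<forall>y. \<phi> (canonical_embedding (of_type s) y) = 0"
      using canonical_projection_embedded[OF \<phi>] by (metis zero_fun_def)
  next
    assume "\<forall>y. \<phi> (canonical_embedding (of_type s) y) = 0"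
    then have "(\<lambda>y. \<phi> (canonical_embedding (of_type s) y)) = 0"
      by (simp add: fun_eq_iff)
    then have "canonical_projection s \<phi> Y = 0" for Y
      using D.dual_zero[of Y] by (simp add: canonical_projection_def canonical_embedding_def)
    then show "canonical_projection s \<phi> = 0"
      by (simp add: fun_eq_iff)
  qed
  then show ?thesis
    by (auto simp: annihilator_def)
qed

end

section \<open>The polynomials seen from a point of the bidual\<close>

text \<open>
  Test functionals \<open>f\<close> come with a factor \<open>\<bar>Y f\<bar> ^ k\<close> that is arbitrarily close to one; this removes it.
\<close>
lemma le_of_power_mult_le:
  fixes x C :: real
  assumes "\<And>a. 0 < a \<Longrightarrow> a < 1 \<Longrightarrow> a ^ k * x \<le> C"
  shows "x \<le> C"
proof (rule tendsto_upperbound)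
  have "((\<lambda>a. a ^ k * x) \<longlongrightarrow> 1 ^ k * x) (at_left 1)"
    by (intro tendsto_intros)
  then show "((\<lambda>a. a ^ k * x) \<longlongrightarrow> x) (at_left 1)"
    by simp
  show "eventually (\<lambda>a. a ^ k * x \<le> C) (at_left 1)"
    using assms by (intro eventually_at_leftI[of 0]) auto
qed simp

lemma quotient_mapping_contraction:
  assumes "quotient_mapping sE sF \<rho>"
  shows "norm (\<rho> x) \<le> norm x"
proof (rule dense_ge)
  fix r
  assume r: "norm x < r"
  then have "0 < r"
    using norm_ge_zero[of x] by linarith
  then have "(1 / r) *\<^sub>R x \<in> ball 0 1"
    using r by (simp add: divide_simps)
  then have "\<rho> ((1 / r) *\<^sub>R x) \<in> ball 0 1"
    using assms by (metis imageI quotient_mapping_def)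
  moreover have "\<rho> ((1 / r) *\<^sub>R x) = (1 / r) *\<^sub>R \<rho> x"
    using assms by (simp add: quotient_mapping_def linear_simps)
  ultimately show "norm (\<rho> x) \<le> r"
    using \<open>0 < r\<close> by (simp add: divide_simps split: if_splits)
qed

text \<open>
  A point \<open>Y\<close> of the unit sphere of the bidual, represented as the weak* limit of \<open>\<rho>\<close> along \<open>U\<close>. The
  degree is a successor because one of the two families of test polynomials splits off a factor \<open>\<rho>\<close>.
\<close>
locale bidual_point = bounded_ultrafilter sE sF "Suc m" U
  for sE :: "'k::real_or_complex \<Rightarrow> 'e::banach \<Rightarrow> 'e" and sF :: "'k \<Rightarrow> 'f::banach \<Rightarrow> 'f"
    and m :: nat and U :: "'e filter" +
  fixes \<rho> :: "'e \<Rightarrow> 'f" and Y :: "('f \<Rightarrow> 'k) \<Rightarrow> 'k"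
  assumes \<rho>: "quotient_mapping sE sF \<rho>"
    and Y: "Y \<in> carr (dual (dual (of_type sF)))" "nrm (dual (dual (of_type sF))) Y = 1"
    and limit: "\<And>f. f \<in> carr (dual (of_type sF)) \<Longrightarrow> ((\<lambda>x. f (\<rho> x)) \<longlongrightarrow> Y f) U"
begin

sublocale E: gauged_space "of_type sE"
  by (rule gauged_of_type[OF sE])

lemma functional_rho:
  assumes f: "f \<in> carr (dual (of_type sF))"
  shows "(\<lambda>x. f (\<rho> x)) \<in> carr (dual (of_type sE))"
proof (rule dual_memI)
  have lin: "\<rho> (x + y) = \<rho> x + \<rho> y" "\<rho> (sE c x) = sF c (\<rho> x)" for x y c
    using \<rho> by (simp_all add: quotient_mapping_def Vector_Spaces.linear_iff)
  show "f (\<rho> (x + y)) = f (\<rho> x) + f (\<rho> y)" for x y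
    using dual_add[OF f] by (simp add: lin)
  show "f (\<rho> (smul (of_type sE) c x)) = c * f (\<rho> x)" for c x
    using dual_smul[OF f, of "\<rho> x" c] by (simp add: lin)
  show "norm (f (\<rho> x)) \<le> nrm (dual (of_type sF)) f * nrm (of_type sE) x" for x
    using F.dual_bound[OF f, of "\<rho> x"]
      mult_left_mono[OF quotient_mapping_contraction[OF \<rho>, of x] D.nrm_nonneg[OF f]] by simp
qed simp

lemma functional_rho_le_one:
  assumes "f \<in> carr (dual (of_type sF))" "nrm (dual (of_type sF)) f \<le> 1" "norm x \<le> 1"
  shows "norm (f (\<rho> x)) \<le> 1"
  using F.dual_memI_bound_one[OF assms(1,2), of "\<rho> x"] quotient_mapping_contraction[OF \<rho>, of x]
    assms(3) by simp

lemma almost_norming: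
  assumes "a < 1"
  obtains f where "f \<in> carr (dual (of_type sF))" "nrm (dual (of_type sF)) f \<le> 1" "a < norm (Y f)"
proof -
  have "\<not> nrm (dual (dual (of_type sF))) Y \<le> a"
    using Y(2) assms by simp
  then show thesis
    using D.dual_nrm_leI[of Y a] that by (meson not_le)
qed

lemma bidual_limit_product:
  assumes P: "(\<lambda>x. sF (f (\<rho> x) ^ k) (L x)) \<in> carr (poly_space (Suc m) sE sF)"
    and f: "f \<in> carr (dual (of_type sF))" and Z: "Z \<in> carr (dual (dual (of_type sF)))"
    and L: "\<And>g. g \<in> carr (dual (of_type sF)) \<Longrightarrow> ((\<lambda>x. g (L x)) \<longlongrightarrow> Z g) U"
  shows "bidual_limit (\<lambda>x. sF (f (\<rho> x) ^ k) (L x)) = smul (dual (dual (of_type sF))) (Y f ^ k) Z"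
proof
  fix g
  show "bidual_limit (\<lambda>x. sF (f (\<rho> x) ^ k) (L x)) g = smul (dual (dual (of_type sF))) (Y f ^ k) Z g"
  proof (cases "g \<in> carr (dual (of_type sF))")
    case True
    have "g (sF (f (\<rho> x) ^ k) (L x)) = f (\<rho> x) ^ k * g (L x)" for x
      using dual_smul[OF True, of "L x" "f (\<rho> x) ^ k"] by simp
    then have "((\<lambda>x. g (sF (f (\<rho> x) ^ k) (L x))) \<longlongrightarrow> Y f ^ k * Z g) U"
      using tendsto_mult[OF tendsto_power[OF limit[OF f]] L[OF True]] by simp
    then show ?thesis
      using bidual_limit_eqI[OF P True] by simp
  next
    case False
    then show ?thesis
      using dual_outside[OF Z] by (simp add: bidual_limit_def)
  qed
qed

text \<open>
  Evaluate \<open>k\<close> at the weakly continuous polynomials \<open>f (\<rho> x) ^ Suc m \<cdot> y\<close>: they have norm at most one,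
  and \<open>lift \<phi>\<close> takes the value \<open>Y f ^ Suc m * \<phi> (J y)\<close> there.
\<close>
lemma restriction_le_of_agree:
  assumes \<phi>: "\<phi> \<in> carr (dual (dual (dual (of_type sF))))"
    and k: "k \<in> carr (dual (poly_space (Suc m) sE sF))"
    and agree: "\<And>P. P \<in> wcont_polys (Suc m) sE sF \<Longrightarrow> k P = lift \<phi> P"
  shows "nrm (dual (of_type sF)) (\<lambda>y. \<phi> (canonical_embedding (of_type sF) y))
    \<le> nrm (dual (poly_space (Suc m) sE sF)) k"
proof (rule F.dual_nrm_leI)
  interpret F': banach_over sF
    by (rule sF)
  fix y
  assume "nrm (of_type sF) y \<le> 1"
  then have y: "norm y \<le> 1"
    by simp
  let ?J = "canonical_embedding (of_type sF)"
  show "norm (\<phi> (?J y)) \<le> nrm (dual (poly_space (Suc m) sE sF)) k"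
  proof (rule le_of_power_mult_le)
    fix a :: real
    assume a: "0 < a" "a < 1"
    obtain f where f: "f \<in> carr (dual (of_type sF))" "nrm (dual (of_type sF)) f \<le> 1" "a < norm (Y f)"
      by (rule almost_norming[OF a(2)])
    let ?P = "\<lambda>x. sF (f (\<rho> x) ^ Suc m) y"
    have wc: "?P \<in> wcont_polys (Suc m) sE sF"
      by (rule finite_rank_power[OF sE sF functional_rho[OF f(1)]])
    then have P: "?P \<in> carr (poly_space (Suc m) sE sF)"
      by (simp add: wcont_polys_def)
    have Jy: "?J y \<in> carr (dual (dual (of_type sF)))"
      by (rule canonical_embedding_bidual[OF sF])
    have "bidual_limit ?P = smul (dual (dual (of_type sF))) (Y f ^ Suc m) (?J y)"
      by (rule bidual_limit_product[OF P f(1) Jy]) (simp add: canonical_embedding_apply)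
    then have "k ?P = Y f ^ Suc m * \<phi> (?J y)"
      unfolding agree[OF wc] lift_apply[OF P] by (simp only: dual_smul[OF \<phi> Jy])
    moreover have "nrm (poly_space (Suc m) sE sF) ?P \<le> 1"
    proof (rule polynomial_nrm_leI)
      fix x :: 'e
      assume "norm x \<le> 1"
      then show "norm (?P x) \<le> 1"
        using functional_rho_le_one[OF f(1,2), of x] y
        by (simp only: F'.norm_scale norm_power) (intro mult_le_one power_le_one; simp)
    qed
    then have "norm (k ?P) \<le> nrm (dual (poly_space (Suc m) sE sF)) k"
      by (rule P.dual_le_nrm[OF k P])
    moreover have "a ^ Suc m * norm (\<phi> (?J y)) \<le> norm (Y f) ^ Suc m * norm (\<phi> (?J y))"
      using a f(3) by (intro mult_right_mono power_mono) auto
    ultimately show "a ^ Suc m * norm (\<phi> (?J y)) \<le> nrm (dual (poly_space (Suc m) sE sF)) k"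
      by (simp only: norm_mult norm_power)
  qed
qed

lemma quotient_times_functional:
  assumes f: "f \<in> carr (dual (of_type sF))" and f1: "nrm (dual (of_type sF)) f \<le> 1"
  shows "(\<lambda>x. sF (f (\<rho> x) ^ m) (\<rho> x)) \<in> carr (poly_space (Suc m) sE sF)" (is "?P \<in> _")
    and "nrm (poly_space (Suc m) sE sF) (\<lambda>x. sF (f (\<rho> x) ^ m) (\<rho> x)) \<le> 1"
    and "bidual_limit (\<lambda>x. sF (f (\<rho> x) ^ m) (\<rho> x)) = smul (dual (dual (of_type sF))) (Y f ^ m) Y"
proof -
  interpret F': banach_over sF
    by (rule sF)
  show P: "?P \<in> carr (poly_space (Suc m) sE sF)"
    using \<rho> by (intro functional_times_operator[OF sE sF functional_rho[OF f]])
      (auto simp: quotient_mapping_def)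
  show "nrm (poly_space (Suc m) sE sF) ?P \<le> 1"
  proof (rule polynomial_nrm_leI)
    fix x :: 'e
    assume "norm x \<le> 1"
    then show "norm (?P x) \<le> 1"
      using functional_rho_le_one[OF f f1, of x] quotient_mapping_contraction[OF \<rho>, of x]
      by (simp only: F'.norm_scale norm_power) (intro mult_le_one power_le_one; simp)
  qed
  show "bidual_limit ?P = smul (dual (dual (of_type sF))) (Y f ^ m) Y"
    by (rule bidual_limit_product[OF P f Y(1) limit])
qed

text \<open>
  The given projection \<open>q\<close> maps \<open>lift \<phi>\<close> to \<open>lift (canonical_projection sF \<phi>)\<close>. It identifies the two since
  they agree on the weakly continuous polynomials, and it fixes the latter since it cannot lower its
  norm. So the HB inequalities apply to the difference of the two lifts.
\<close>
lemma
  assumes HB: "HB_subspace (poly_space (Suc m) sE sF) (wcont_polys (Suc m) sE sF)"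
    and \<phi>: "\<phi> \<in> carr (dual (dual (dual (of_type sF))))"
  shows lift_difference_nrm:
      "nrm (dual (poly_space (Suc m) sE sF)) (lift \<phi> - lift (canonical_projection sF \<phi>))
        \<le> nrm (dual (dual (dual (of_type sF)))) \<phi>"
    and lift_strict:
      "lift \<phi> \<noteq> lift (canonical_projection sF \<phi>) \<Longrightarrow>
        nrm (dual (of_type sF)) (\<lambda>y. \<phi> (canonical_embedding (of_type sF) y))
        < nrm (dual (dual (dual (of_type sF)))) \<phi>"
proof -
  let ?X = "poly_space (Suc m) sE sF" and ?W = "wcont_polys (Suc m) sE sF"
  let ?\<psi> = "canonical_projection sF \<phi>"
  let ?r = "\<lambda>y. \<phi> (canonical_embedding (of_type sF) y)"
  interpret X: gauged_space "dual ?X"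
    by (rule P.gauged_dual)
  obtain q where q: "linear_between (dual ?X) (dual ?X) q"
    and idem: "\<And>f. f \<in> carr (dual ?X) \<Longrightarrow> q (q f) = q f"
    and ker: "{f \<in> carr (dual ?X). q f = 0} = annihilator ?X ?W"
    and strict: "\<And>f. f \<in> carr (dual ?X) \<Longrightarrow> f \<noteq> q f \<Longrightarrow> nrm (dual ?X) (q f) < nrm (dual ?X) f"
    and compl: "\<And>f. f \<in> carr (dual ?X) \<Longrightarrow> f \<noteq> q f \<Longrightarrow> nrm (dual ?X) (f - q f) \<le> nrm (dual ?X) f"
    using HB unfolding HB_subspace_def by blast
  have q_mem: "q f \<in> carr (dual ?X)" if "f \<in> carr (dual ?X)" for f
    using q that by (simp add: linear_between_def)
  have q_diff: "q (f - g) = q f - q g" if fg: "f \<in> carr (dual ?X)" "g \<in> carr (dual ?X)" for f g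
  proof -
    have "q (f - g + g) = q (f - g) + q g"
      using q fg P.dual_diff_mem[OF fg] by (simp only: linear_between_def)
    then show ?thesis
      by simp
  qed
  have agree_iff: "q f = q g \<longleftrightarrow> (\<forall>P\<in>?W. f P = g P)"
    if fg: "f \<in> carr (dual ?X)" "g \<in> carr (dual ?X)" for f g
  proof -
    have "q f = q g \<longleftrightarrow> f - g \<in> annihilator ?X ?W"
      unfolding ker[symmetric] using q_diff[OF fg] P.dual_diff_mem[OF fg] by auto
    also have "\<dots> \<longleftrightarrow> (\<forall>P\<in>?W. f P = g P)"
      using P.dual_diff_mem[OF fg] by (simp add: annihilator_def)
    finally show ?thesis .
  qed
  have \<psi>: "?\<psi> \<in> carr (dual (dual (dual (of_type sF))))"
    by (rule canonical_projection_mem[OF sF \<phi>])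
  note mem = lift_mem[OF \<phi>] lift_mem[OF \<psi>]
  have same: "lift \<phi> P = lift ?\<psi> P" if P: "P \<in> ?W" for P
  proof -
    obtain y where y: "bidual_limit P = canonical_embedding (of_type sF) y"
      by (rule bidual_limit_wcont[OF P])
    have "P \<in> carr ?X"
      using P by (simp add: wcont_polys_def)
    then show ?thesis
      using canonical_projection_embedded[OF sF \<phi>] by (simp only: lift_apply y)
  qed
  have low: "nrm (dual (of_type sF)) ?r \<le> nrm (dual ?X) k"
    if "k \<in> carr (dual ?X)" "\<And>P. P \<in> ?W \<Longrightarrow> k P = lift ?\<psi> P" for k
    using that same by (intro restriction_le_of_agree[OF \<phi>]) auto
  have fix\<psi>: "q (lift ?\<psi>) = lift ?\<psi>"
  proof (rule ccontr)
    assume "q (lift ?\<psi>) \<noteq> lift ?\<psi>"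
    then have "nrm (dual ?X) (q (lift ?\<psi>)) < nrm (dual ?X) (lift ?\<psi>)"
      using strict[OF mem(2)] by metis
    also have "\<dots> \<le> nrm (dual (dual (dual (of_type sF)))) ?\<psi>"
      by (rule lift_nrm[OF \<psi>])
    also have "\<dots> \<le> nrm (dual (of_type sF)) ?r"
      by (rule canonical_projection_nrm[OF sF \<phi>])
    also have "\<dots> \<le> nrm (dual ?X) (q (lift ?\<psi>))"
    proof (rule low[OF q_mem[OF mem(2)]])
      show "q (lift ?\<psi>) P = lift ?\<psi> P" if "P \<in> ?W" for P
        using agree_iff[OF q_mem[OF mem(2)] mem(2)] idem[OF mem(2)] that by blast
    qed
    finally show False
      by simp
  qed
  have q\<phi>: "q (lift \<phi>) = lift ?\<psi>"
    using agree_iff[OF mem] same fix\<psi> by simp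
  show "nrm (dual ?X) (lift \<phi> - lift ?\<psi>) \<le> nrm (dual (dual (dual (of_type sF)))) \<phi>"
  proof (cases "lift \<phi> = lift ?\<psi>")
    case True
    have "nrm (dual ?X) (lift \<phi> - lift ?\<psi>) \<le> 0"
      by (rule P.dual_nrm_leI) (simp add: True)
    then show ?thesis
      using B.dual_nrm_nonneg[OF \<phi>] by linarith
  next
    case False
    then show ?thesis
      using compl[OF mem(1)] q\<phi> lift_nrm[OF \<phi>] by simp
  qed
  show "nrm (dual (of_type sF)) ?r < nrm (dual (dual (dual (of_type sF)))) \<phi>"
    if "lift \<phi> \<noteq> lift ?\<psi>"
    using low[OF mem(2)] strict[OF mem(1)] q\<phi> that lift_nrm[OF \<phi>] by simp
qed

end

lemma bidual_point_exists:
  fixes sE :: "'k::real_or_complex \<Rightarrow> 'e::banach \<Rightarrow> 'e" and sF :: "'k \<Rightarrow> 'f::banach \<Rightarrow> 'f"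
  assumes sE: "banach_over sE" and sF: "banach_over sF" and \<rho>: "quotient_mapping sE sF \<rho>"
    and Y: "Y \<in> carr (dual (dual (of_type sF)))" "nrm (dual (dual (of_type sF))) Y = 1"
  obtains U where "bidual_point sE sF U \<rho> Y"
proof -
  obtain U where U: "ultrafilter U" "eventually (\<lambda>x. norm x \<le> 1) U"
    "\<And>f. f \<in> carr (dual (of_type sF)) \<Longrightarrow> ((\<lambda>x. f (\<rho> x)) \<longlongrightarrow> Y f) U"
    using goldstine_ultrafilter[OF sF \<rho> Y(1)] Y(2) by auto
  then have "bidual_point sE sF U \<rho> Y"
    using assms
    by (intro bidual_point.intro bounded_ultrafilter.intro bidual_point_axioms.intro) auto
  then show thesis
    by (rule that)
qed

section \<open>The HB-property of a quotient in its bidual\<close>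

theorem proposition4p4:
  fixes sE :: "'k::real_or_complex \<Rightarrow> 'e::banach \<Rightarrow> 'e"
    and sF :: "'k \<Rightarrow> 'f::banach \<Rightarrow> 'f"
    and \<rho> :: "'e \<Rightarrow> 'f"
    and n :: nat
  assumes "banach_over sE" and "banach_over sF"
    and "quotient_mapping sE sF \<rho>"
    and "1 \<le> n"
    and "HB_subspace (poly_space n sE sF) (wcont_polys n sE sF)"
  shows "HB_subspace (dual (dual (of_type sF))) (range (canonical_embedding (of_type sF)))"
proof -
  interpret F: gauged_space "of_type sF"
    by (rule gauged_of_type[OF assms(2)])
  interpret D: gauged_space "dual (of_type sF)"
    by (rule F.gauged_dual)
  interpret B: gauged_space "dual (dual (of_type sF))"
    by (rule D.gauged_dual)
  interpret T: gauged_space "dual (dual (dual (of_type sF)))"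
    by (rule B.gauged_dual)
  let ?B = "dual (dual (of_type sF))" and ?T = "dual (dual (dual (of_type sF)))"
  let ?q = "canonical_projection sF"
  obtain m where n: "n = Suc m"
    using assms(4) by (cases n) auto
  note HB = assms(5)[unfolded n]
  have unit_compl: "norm ((\<phi> - ?q \<phi>) Y) \<le> nrm ?T \<phi>"
    and unit_strict: "\<phi> Y \<noteq> ?q \<phi> Y \<Longrightarrow> nrm ?T (?q \<phi>) < nrm ?T \<phi>"
    if \<phi>: "\<phi> \<in> carr ?T" and Y: "Y \<in> carr ?B" "nrm ?B Y = 1" for \<phi> Y
  proof -
    obtain U where "bidual_point sE sF U \<rho> Y"
      by (rule bidual_point_exists[OF assms(1-3) Y])
    then interpret U: bidual_point sE sF m U \<rho> Y .
    let ?d = "U.lift \<phi> - U.lift (?q \<phi>)"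
    have \<psi>: "?q \<phi> \<in> carr ?T"
      by (rule canonical_projection_mem[OF assms(2) \<phi>])
    have on_test: "?d (\<lambda>x. sF (f (\<rho> x) ^ m) (\<rho> x)) = Y f ^ m * (\<phi> - ?q \<phi>) Y"
      if f: "f \<in> carr (dual (of_type sF))" "nrm (dual (of_type sF)) f \<le> 1" for f
      using U.quotient_times_functional[OF f]
      by (simp only: fun_diff_def U.lift_apply dual_smul[OF \<phi> Y(1)] dual_smul[OF \<psi> Y(1)]
          right_diff_distrib)
    have test: "norm (Y f) ^ m * norm ((\<phi> - ?q \<phi>) Y) \<le> nrm (dual (poly_space (Suc m) sE sF)) ?d"
      if f: "f \<in> carr (dual (of_type sF))" "nrm (dual (of_type sF)) f \<le> 1" for f
      using U.P.dual_le_nrm[OF U.P.dual_diff_mem[OF U.lift_mem[OF \<phi>] U.lift_mem[OF \<psi>]]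
          U.quotient_times_functional(1,2)[OF f]]
      unfolding on_test[OF f] by (simp only: norm_mult norm_power)
    have "norm ((\<phi> - ?q \<phi>) Y) \<le> nrm (dual (poly_space (Suc m) sE sF)) ?d"
    proof (rule le_of_power_mult_le)
      fix a :: real
      assume a: "0 < a" "a < 1"
      obtain f where f: "f \<in> carr (dual (of_type sF))" "nrm (dual (of_type sF)) f \<le> 1" "a < norm (Y f)"
        by (rule U.almost_norming[OF a(2)])
      have "a ^ m * norm ((\<phi> - ?q \<phi>) Y) \<le> norm (Y f) ^ m * norm ((\<phi> - ?q \<phi>) Y)"
        using a f(3) by (intro mult_right_mono power_mono) auto
      then show "a ^ m * norm ((\<phi> - ?q \<phi>) Y) \<le> nrm (dual (poly_space (Suc m) sE sF)) ?d"
        using test[OF f(1,2)] by linarith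
    qed
    then show "norm ((\<phi> - ?q \<phi>) Y) \<le> nrm ?T \<phi>"
      using U.lift_difference_nrm[OF HB \<phi>] by linarith
    assume "\<phi> Y \<noteq> ?q \<phi> Y"
    moreover obtain f where f: "f \<in> carr (dual (of_type sF))" "nrm (dual (of_type sF)) f \<le> 1" "0 < norm (Y f)"
      using U.almost_norming[of 0] by auto
    ultimately have "U.lift \<phi> \<noteq> U.lift (?q \<phi>)"
      using on_test[OF f(1,2)] by auto
    then show "nrm ?T (?q \<phi>) < nrm ?T \<phi>"
      using U.lift_strict[OF HB \<phi>] canonical_projection_nrm[OF assms(2) \<phi>] by linarith
  qed
  \<comment> \<open>By homogeneity the points of norm one decide; points of seminorm zero do not contribute.\<close>
  have bounds: "nrm ?T (?q \<phi>) < nrm ?T \<phi> \<and> nrm ?T (\<phi> - ?q \<phi>) \<le> nrm ?T \<phi>"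
    if \<phi>: "\<phi> \<in> carr ?T" and neq: "\<phi> \<noteq> ?q \<phi>" for \<phi>
  proof
    have \<psi>: "?q \<phi> \<in> carr ?T"
      by (rule canonical_projection_mem[OF assms(2) \<phi>])
    note d = B.dual_diff_mem[OF \<phi> \<psi>]
    let ?u = "\<lambda>Y. smul ?B (of_real (1 / nrm ?B Y)) Y"
    have null: "(\<phi> - ?q \<phi>) Y = 0" if "Y \<in> carr ?B" "nrm ?B Y = 0" for Y
      using B.dual_bound[OF d that(1)] that(2) by simp
    obtain Y where "(\<phi> - ?q \<phi>) Y \<noteq> 0"
      using neq by (auto simp: fun_eq_iff)
    then have Y: "Y \<in> carr ?B" "nrm ?B Y \<noteq> 0" "(\<phi> - ?q \<phi>) Y \<noteq> 0"
      using dual_outside[OF d] null by blast+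
    have "(\<phi> - ?q \<phi>) (?u Y) \<noteq> 0"
      unfolding dual_smul[OF d Y(1)] using Y(2,3) by simp
    then have "\<phi> (?u Y) \<noteq> ?q \<phi> (?u Y)"
      by simp
    then show "nrm ?T (?q \<phi>) < nrm ?T \<phi>"
      by (rule unit_strict[OF \<phi> B.smul_mem[OF Y(1)] B.unit_multiple[OF Y(1,2)]])
    show "nrm ?T (\<phi> - ?q \<phi>) \<le> nrm ?T \<phi>"
    proof (rule B.dual_nrm_leI)
      fix Y
      assume Y: "Y \<in> carr ?B" "nrm ?B Y \<le> 1"
      show "norm ((\<phi> - ?q \<phi>) Y) \<le> nrm ?T \<phi>"
      proof (cases "nrm ?B Y = 0")
        case True
        then show ?thesis
          using null[OF Y(1)] B.dual_nrm_nonneg[OF \<phi>] by simp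
      next
        case False
        have "norm ((\<phi> - ?q \<phi>) (?u Y)) \<le> nrm ?T \<phi>"
          by (rule unit_compl[OF \<phi> B.smul_mem[OF Y(1)] B.unit_multiple[OF Y(1) False]])
        then have "norm ((\<phi> - ?q \<phi>) Y) \<le> nrm ?T \<phi> * nrm ?B Y"
          using False B.nrm_nonneg[OF Y(1)] unfolding dual_smul[OF d Y(1)]
          by (simp add: norm_mult norm_divide field_simps)
        also have "\<dots> \<le> nrm ?T \<phi>"
          using mult_left_mono[OF Y(2) B.dual_nrm_nonneg[OF \<phi>]] by simp
        finally show ?thesis .
      qed
    qed
  qed
  show ?thesis
    unfolding HB_subspace_def
    using closed_range_canonical_embedding[OF assms(2)] canonical_projection_linear[OF assms(2)]
      canonical_projection_idempotent[OF assms(2)] canonical_projection_kernel[OF assms(2)] bounds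
    by blast
qed

end
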